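(* In the OQAM block model $\mathbf{y}=\boldsymbol{\Gamma}\mathbf{x}+\mathbf{v}$ described in the context (with known channel state information), the output of the real-only equalizer (ROE) is the real-only equivalent of the output $\hat{\mathbf{x}}_{\mathrm{WLE}}$ of the widely linear equalizer (WLE), and is given by $$\hat{\mathbf{x}}_{\mathrm{ROE}} = 2\mathbf{A}\,\hat{\mathbf{x}}_{\mathrm{WLE}}.$$
   Context: Notation: $j$ is the imaginary unit; ${}^\top$, ${}^*$, ${}^\dagger$ denote transpose, entrywise complex conjugate, and conjugate transpose; $E$ is expectation. Signal model. Let $\nu\ge 1$ be an integer, and let vectors be indexed by $n=0,\dots,2\nu-1$. The real random vector $\mathbf{a}=[a(0),\dots,a(2\nu-1)]^\top$ has independent entries, each uniformly distributed on $\{\pm A,\pm 3A,\dots,\pm(N-1)A\}$, where $A>0$, $N\in\{2,4,8,\dots\}$, normalized so that the average symbol energy $\frac{2A^2}{N}\{1^2+3^2+\dots+(N-1)^2\}$ equals $1$. The transmitted OQAM vector $\mathbf{x}$ has entries $x(n)=a(n)$ for $n$ even and $x(n)=j\,a(n)$ for $n$ odd. Channel. $h(0),\dots,h(L)$ are the (deterministic, complex, not all zero) taps of a causal discrete-time channel, $h(k)=0$ for other $k$, and $\gamma(k)=\sum_{l} h(l+k)h^*(l)$. $\boldsymbol{\Gamma}$ is the $2\nu\times 2\nu$ Hermitian positive-definite Toeplitz matrix with $(m,n)$ entry $\gamma(m-n)$ (the channel autocorrelation matrix). The sampled matched-filter output is $\mathbf{y}=\boldsymbol{\Gamma}\mathbf{x}+\mathbf{v}$,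 where $\mathbf{v}$ is a zero-mean, circularly symmetric complex Gaussian noise vector independent of $\mathbf{x}$ with $E[\mathbf{v}\mathbf{v}^\dagger]=\sigma^2\boldsymbol{\Gamma}$ and $E[\mathbf{v}\mathbf{v}^\top]=0$ (hence $E[\mathbf{v}^*\mathbf{v}^\dagger]=0$), where $\sigma^2=2N_0>0$. Matrices. $\mathbf{A}=\mathrm{diag}[\tfrac12,\tfrac{-j}{2},\tfrac12,\dots,\tfrac{-j}{2}]$ and $\mathbf{B}=\mathrm{diag}[1,-1,1,\dots,-1]$, both $2\nu\times 2\nu$ (the matrix $\mathbf{A}$ is unrelated to the scalar amplitude $A$). Thus $\mathbf{x}=2\mathbf{A}^\dagger\mathbf{a}$. ROE. Put $\mathbf{y}_a=[\mathrm{Re}\,y(0),\ \mathrm{Im}\,y(1),\ \mathrm{Re}\,y(2),\dots,\mathrm{Im}\,y(2\nu-1)]^\top=\mathbf{A}(\mathbf{y}+\mathbf{B}\mathbf{y}^* )$ and $\boldsymbol{\Gamma}_a=2\mathbf{A}(\boldsymbol{\Gamma}+\mathbf{B}\boldsymbol{\Gamma}^\top\mathbf{B})\mathbf{A}^\dagger$. The output of the ROE is $$\hat{\mathbf{x}}_{\mathrm{ROE}}=\Big[\boldsymbol{\Gamma}_a+\tfrac{\sigma^2}{2}\mathbf{I}\Big]^{-1}\mathbf{y}_a .$$ WLE. The output of the WLE is $\hat{\mathbf{x}}_{\mathrm{WLE}}=\mathbf{C}\mathbf{y}+\mathbf{D}\mathbf{y}^*$, where the complex $2\nu\times 2\nu$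 coefficient matrices $\mathbf{C},\mathbf{D}$ are those determined by the orthogonality principle (widely linear MMSE estimation of $\mathbf{x}$ from $\mathbf{y}$): $$E[(\mathbf{x}-\hat{\mathbf{x}}_{\mathrm{WLE}})\mathbf{y}^\dagger]=0,\qquad E[(\mathbf{x}-\hat{\mathbf{x}}_{\mathrm{WLE}})^*\mathbf{y}^\dagger]=0 .$$ *)

theory Defs
  imports
    "HOL-Probability.Probability"
    "Jordan_Normal_Form.Gauss_Jordan_Elimination"
    "Jordan_Normal_Form.Schur_Decomposition"
begin

unbundle no vec_syntax
hide_type (open) Finite_Cartesian_Product.vec
hide_const (open) Finite_Cartesian_Product.vec

text \<open>
  Vectors and matrices of dimension \<open>2\<nu>\<close> are those of the AFP entry Jordan_Normal_Form,
  indexed from 0.  A random vector of dimension \<open>n\<close> is given by its family of entries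
  \<open>X :: nat \<Rightarrow> 'w \<Rightarrow> _\<close>, of which only the indices below \<open>n\<close> are used.
\<close>

definition rvec :: "nat \<Rightarrow> (nat \<Rightarrow> 'w \<Rightarrow> 'b) \<Rightarrow> 'w \<Rightarrow> 'b vec" where
  "rvec n X \<omega> = vec n (\<lambda>i. X i \<omega>)"

text \<open>The same random vector as a map into the product space \<open>PiM {..<n} borel\<close>, for
  statements about joint laws.\<close>

definition rfun :: "nat \<Rightarrow> (nat \<Rightarrow> 'w \<Rightarrow> 'b) \<Rightarrow> 'w \<Rightarrow> nat \<Rightarrow> 'b" where
  "rfun n X \<omega> = (\<lambda>i\<in>{..<n}. X i \<omega>)"

definition outer :: "complex vec \<Rightarrow> complex vec \<Rightarrow> complex mat" where
  "outer u w = mat (dim_vec u) (dim_vec w) (\<lambda>(i, k). u $ i * w $ k)"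

definition expect_mat :: "'w measure \<Rightarrow> nat \<Rightarrow> ('w \<Rightarrow> complex mat) \<Rightarrow> complex mat" where
  "expect_mat M n F = mat n n (\<lambda>(i, k). integral\<^sup>L M (\<lambda>\<omega>. F \<omega> $$ (i, k)))"


definition pam_symbols :: "real \<Rightarrow> nat \<Rightarrow> real set" where
  "pam_symbols amp N = {of_int i * amp | i :: int. odd i \<and> \<bar>i\<bar> \<le> int N - 1}"

definition uniform_rv :: "'w measure \<Rightarrow> real set \<Rightarrow> ('w \<Rightarrow> real) \<Rightarrow> bool" where
  "uniform_rv M S X \<longleftrightarrow> X \<in> borel_measurable M \<and>
     distr M borel X = distr (measure_pmf (pmf_of_set S)) borel (\<lambda>s. s)"

definition oqam :: "(nat \<Rightarrow> 'w \<Rightarrow> real) \<Rightarrow> nat \<Rightarrow> 'w \<Rightarrow> complex" where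
  "oqam a n \<omega> = (if even n then complex_of_real (a n \<omega>) else \<i> * complex_of_real (a n \<omega>))"


text \<open>The taps are a function on all integers that vanishes outside \<open>{0..L}\<close>; hence the sum
  over \<open>l\<close> may be restricted to that range.\<close>

definition chan_autocorr :: "nat \<Rightarrow> (int \<Rightarrow> complex) \<Rightarrow> int \<Rightarrow> complex" where
  "chan_autocorr L h k = (\<Sum>l\<in>{0..int L}. h (l + k) * cnj (h l))"

definition Gamma_mat :: "nat \<Rightarrow> nat \<Rightarrow> (int \<Rightarrow> complex) \<Rightarrow> complex mat" where
  "Gamma_mat \<nu> L h = mat (2 * \<nu>) (2 * \<nu>) (\<lambda>(m, n). chan_autocorr L h (int m - int n))"


text \<open>Normal law on the real line, point masses included.\<close>

definition gaussian_rv :: "'w measure \<Rightarrow> ('w \<Rightarrow> real) \<Rightarrow> bool" where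
  "gaussian_rv M X \<longleftrightarrow> X \<in> borel_measurable M \<and>
     ((\<exists>\<mu>. AE \<omega> in M. X \<omega> = \<mu>) \<or>
      (\<exists>\<mu> s. s > 0 \<and> distributed M lborel X (\<lambda>t. ennreal (normal_density \<mu> s t))))"

text \<open>Every real linear functional of \<open>(v 0, \<dots>, v (n - 1))\<close> has the form
  \<open>Re (\<Sum>i<n. c i * v i)\<close>, so this is joint Gaussianity of all real and imaginary parts.\<close>

definition complex_gaussian_vec :: "'w measure \<Rightarrow> nat \<Rightarrow> (nat \<Rightarrow> 'w \<Rightarrow> complex) \<Rightarrow> bool" where
  "complex_gaussian_vec M n v \<longleftrightarrow> (\<forall>i<n. v i \<in> borel_measurable M) \<and>
     (\<forall>c :: nat \<Rightarrow> complex. gaussian_rv M (\<lambda>\<omega>. Re (\<Sum>i<n. c i * v i \<omega>)))"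

definition circularly_symmetric :: "'w measure \<Rightarrow> nat \<Rightarrow> (nat \<Rightarrow> 'w \<Rightarrow> complex) \<Rightarrow> bool" where
  "circularly_symmetric M n v \<longleftrightarrow>
     (\<forall>\<theta> :: real. distr M (PiM {..<n} (\<lambda>_. borel)) (rfun n (\<lambda>i \<omega>. cis \<theta> * v i \<omega>))
               = distr M (PiM {..<n} (\<lambda>_. borel)) (rfun n v))"

definition received ::
  "nat \<Rightarrow> complex mat \<Rightarrow> (nat \<Rightarrow> 'w \<Rightarrow> real) \<Rightarrow> (nat \<Rightarrow> 'w \<Rightarrow> complex) \<Rightarrow> 'w \<Rightarrow> complex vec" where
  "received \<nu> G a v \<omega> = G *\<^sub>v rvec (2 * \<nu>) (oqam a) \<omega> + rvec (2 * \<nu>) v \<omega>"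


definition A_mat :: "nat \<Rightarrow> complex mat" where
  "A_mat \<nu> = mat_diag (2 * \<nu>) (\<lambda>n. if even n then 1 / 2 else - \<i> / 2)"

definition B_mat :: "nat \<Rightarrow> complex mat" where
  "B_mat \<nu> = mat_diag (2 * \<nu>) (\<lambda>n. if even n then 1 else - 1)"

definition real_only :: "complex vec \<Rightarrow> complex vec" where
  "real_only z = vec (dim_vec z) (\<lambda>n. complex_of_real (if even n then Re (z $ n) else Im (z $ n)))"

lemma real_only_eq:
  assumes "z \<in> carrier_vec (2 * \<nu>)"
  shows "real_only z = A_mat \<nu> *\<^sub>v (z + B_mat \<nu> *\<^sub>v conjugate z)"
proof -
  have diag: "mat_diag n f *\<^sub>v u = vec n (\<lambda>i. f i * u $ i)" if u: "u \<in> carrier_vec n"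
    for n f and u :: "complex vec"
  proof (intro eq_vecI)
    fix i assume i: "i < dim_vec (vec n (\<lambda>i. f i * u $ i))"
    have "(\<Sum>k = 0..<n. (if i = k then f k else 0) * u $ k) = f i * u $ i"
      using i by (simp add: if_distrib[of "\<lambda>t. t * _"] sum.delta cong: if_cong)
    then show "(mat_diag n f *\<^sub>v u) $ i = vec n (\<lambda>i. f i * u $ i) $ i"
      using i u by (simp add: mat_diag_def scalar_prod_def)
  qed (simp add: mat_diag_def)
  have c: "conjugate z \<in> carrier_vec (2 * \<nu>)" using assms by simp
  have d: "z + vec (2 * \<nu>) (\<lambda>i. (if even i then 1 else - 1) * conjugate z $ i) \<in> carrier_vec (2 * \<nu>)"
    using assms by simp
  show ?thesis
    unfolding A_mat_def B_mat_def diag[OF c] diag[OF d]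
    using assms by (intro eq_vecI) (auto simp: real_only_def complex_eq_iff)
qed

definition Gamma_a :: "nat \<Rightarrow> complex mat \<Rightarrow> complex mat" where
  "Gamma_a \<nu> G = 2 \<cdot>\<^sub>m (A_mat \<nu> * (G + B_mat \<nu> * transpose_mat G * B_mat \<nu>) * mat_adjoint (A_mat \<nu>))"

definition roe :: "nat \<Rightarrow> complex mat \<Rightarrow> real \<Rightarrow> complex vec \<Rightarrow> complex vec" where
  "roe \<nu> G \<sigma>2 y =
     the (mat_inverse (Gamma_a \<nu> G + complex_of_real (\<sigma>2 / 2) \<cdot>\<^sub>m 1\<^sub>m (2 * \<nu>))) *\<^sub>v real_only y"


definition widely_linear :: "complex mat \<Rightarrow> complex mat \<Rightarrow> complex vec \<Rightarrow> complex vec" where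
  "widely_linear C D y = C *\<^sub>v y + D *\<^sub>v conjugate y"

definition orthogonality ::
  "'w measure \<Rightarrow> nat \<Rightarrow> ('w \<Rightarrow> complex vec) \<Rightarrow> ('w \<Rightarrow> complex vec) \<Rightarrow> complex mat \<Rightarrow> complex mat \<Rightarrow> bool"
where
  "orthogonality M n x y C D \<longleftrightarrow>
     expect_mat M n (\<lambda>\<omega>. outer (x \<omega> - widely_linear C D (y \<omega>)) (conjugate (y \<omega>))) = 0\<^sub>m n n \<and>
     expect_mat M n (\<lambda>\<omega>. outer (conjugate (x \<omega> - widely_linear C D (y \<omega>))) (conjugate (y \<omega>))) = 0\<^sub>m n n"

text \<open>A definite description: any result about \<open>wle\<close> has to establish that the orthogonality
  principle has exactly one solution.  Likewise, for \<open>roe\<close> above, \<open>mat_inverse\<close> returns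
  \<open>None\<close> on singular matrices, so invertibility is not built in.\<close>

definition wle_coeffs ::
  "'w measure \<Rightarrow> nat \<Rightarrow> ('w \<Rightarrow> complex vec) \<Rightarrow> ('w \<Rightarrow> complex vec) \<Rightarrow> complex mat \<times> complex mat"
where
  "wle_coeffs M n x y =
     (THE (C, D). C \<in> carrier_mat n n \<and> D \<in> carrier_mat n n \<and> orthogonality M n x y C D)"

definition wle ::
  "'w measure \<Rightarrow> nat \<Rightarrow> ('w \<Rightarrow> complex vec) \<Rightarrow> ('w \<Rightarrow> complex vec) \<Rightarrow> 'w \<Rightarrow> complex vec"
where
  "wle M n x y \<omega> = (case wle_coeffs M n x y of (C, D) \<Rightarrow> widely_linear C D (y \<omega>))"

end

theory Submission
  imports Defs
begin

text \<open>
  Write \<open>G\<close> for the channel autocorrelation matrix, \<open>H\<close> for its transpose (equal to its entrywise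
  conjugate) and \<open>K = G + B H B + \<sigma>\<^sup>2 I\<close>.  An OQAM vector satisfies \<open>x\<^sup>* = B x\<close>, so all second moments
  of \<open>y\<close> and \<open>y\<^sup>*\<close> are polynomials in \<open>G\<close>, \<open>H\<close> and \<open>B\<close>.  After cancelling \<open>G\<close> and \<open>H\<close>, which are
  invertible, the two orthogonality conditions read \<open>I = C (G + \<sigma>\<^sup>2 I) + D H B\<close> and
  \<open>B = C G B + D (H + \<sigma>\<^sup>2 I)\<close>.  Multiplying the second by \<open>B\<close> and subtracting leaves \<open>D = C B\<close> and
  \<open>C K = I\<close>; so the WLE output is \<open>K\<inverse> (y + B y\<^sup>*)\<close>, a vector again fixed by \<open>z \<mapsto> B z\<^sup>*\<close>.  On the
  other side \<open>\<Gamma>\<^sub>a + (\<sigma>\<^sup>2/2) I = 2 A K A\<^sup>\<dagger>\<close> with \<open>4 A A\<^sup>\<dagger> = I\<close>, so the ROE output is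
  \<open>2 A K\<inverse> (y + B y\<^sup>*)\<close>.
\<close>

section \<open>Square-integrable random vectors and their correlation matrices\<close>

text \<open>The integral of a nonintegrable function is 0 by convention, so linearity of expectation
  has to be earned. Finite second moments form a class closed under linear combinations and
  conjugation in which every product of two members is integrable.\<close>

definition sq_integrable :: "'w measure \<Rightarrow> ('w \<Rightarrow> complex) \<Rightarrow> bool" where
  "sq_integrable M f \<longleftrightarrow> f \<in> borel_measurable M \<and> integrable M (\<lambda>\<omega>. (cmod (f \<omega>))\<^sup>2)"

lemma sq_integrable_mult:
  assumes "sq_integrable M f" "sq_integrable M g"
  shows "integrable M (\<lambda>\<omega>. f \<omega> * g \<omega>)"
proof (rule Bochner_Integration.integrable_bound)
  show "integrable M (\<lambda>\<omega>. (cmod (f \<omega>))\<^sup>2 + (cmod (g \<omega>))\<^sup>2)"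
    using assms by (auto simp: sq_integrable_def)
  show "(\<lambda>\<omega>. f \<omega> * g \<omega>) \<in> borel_measurable M"
    using assms by (auto simp: sq_integrable_def)
  have "a * b \<le> a\<^sup>2 + b\<^sup>2" if "a \<ge> 0" "b \<ge> 0" for a b :: real
    using sum_squares_bound[of a b] mult_nonneg_nonneg[OF that] by simp
  then show "AE \<omega> in M. norm (f \<omega> * g \<omega>) \<le> norm ((cmod (f \<omega>))\<^sup>2 + (cmod (g \<omega>))\<^sup>2)"
    by (simp add: norm_mult)
qed

lemma sq_integrable_add:
  assumes "sq_integrable M f" "sq_integrable M g"
  shows "sq_integrable M (\<lambda>\<omega>. f \<omega> + g \<omega>)"
  unfolding sq_integrable_def
proof
  show meas: "(\<lambda>\<omega>. f \<omega> + g \<omega>) \<in> borel_measurable M"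
    using assms by (auto simp: sq_integrable_def)
  show "integrable M (\<lambda>\<omega>. (cmod (f \<omega> + g \<omega>))\<^sup>2)"
  proof (rule Bochner_Integration.integrable_bound)
    show "integrable M (\<lambda>\<omega>. 2 * (cmod (f \<omega>))\<^sup>2 + 2 * (cmod (g \<omega>))\<^sup>2)"
      using assms by (auto simp: sq_integrable_def)
    show "(\<lambda>\<omega>. (cmod (f \<omega> + g \<omega>))\<^sup>2) \<in> borel_measurable M" using meas by simp
    have "(cmod (a + b))\<^sup>2 \<le> 2 * (cmod a)\<^sup>2 + 2 * (cmod b)\<^sup>2" for a b
    proof -
      have "(cmod (a + b))\<^sup>2 \<le> (cmod a + cmod b)\<^sup>2"
        by (intro power_mono norm_triangle_ineq) simp
      also have "\<dots> \<le> 2 * (cmod a)\<^sup>2 + 2 * (cmod b)\<^sup>2"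
        using sum_squares_bound[of "cmod a" "cmod b"] by (simp add: power2_sum)
      finally show ?thesis .
    qed
    then show "AE \<omega> in M. norm ((cmod (f \<omega> + g \<omega>))\<^sup>2)
        \<le> norm (2 * (cmod (f \<omega>))\<^sup>2 + 2 * (cmod (g \<omega>))\<^sup>2)" by simp
  qed
qed

lemma sq_integrable_cmult:
  "sq_integrable M f \<Longrightarrow> sq_integrable M (\<lambda>\<omega>. c * f \<omega>)"
  by (auto simp: sq_integrable_def norm_mult power_mult_distrib)

lemma sq_integrable_cnj:
  "sq_integrable M f \<Longrightarrow> sq_integrable M (\<lambda>\<omega>. cnj (f \<omega>))"
  unfolding sq_integrable_def
  by (auto intro: borel_measurable_continuous_on[OF continuous_on_cnj[OF continuous_on_id]])

lemma sq_integrable_sum: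
  "(\<And>i. i \<in> I \<Longrightarrow> sq_integrable M (f i)) \<Longrightarrow> sq_integrable M (\<lambda>\<omega>. \<Sum>i\<in>I. f i \<omega>)"
proof (induction I rule: infinite_finite_induct)
  case (insert x F)
  then show ?case by (simp add: sq_integrable_add)
qed (simp_all add: sq_integrable_def)

text \<open>The dimension is required at every \<omega>, not almost everywhere, so that entries can
  be taken pointwise under the integral.\<close>

definition sq_integrable_vec :: "'w measure \<Rightarrow> nat \<Rightarrow> ('w \<Rightarrow> complex vec) \<Rightarrow> bool" where
  "sq_integrable_vec M n U \<longleftrightarrow>
     (\<forall>\<omega>. U \<omega> \<in> carrier_vec n) \<and> (\<forall>i<n. sq_integrable M (\<lambda>\<omega>. U \<omega> $ i))"

lemma sq_integrable_vecD:
  assumes "sq_integrable_vec M n U"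
  shows "U \<omega> \<in> carrier_vec n" "dim_vec (U \<omega>) = n" "i < n \<Longrightarrow> sq_integrable M (\<lambda>\<omega>. U \<omega> $ i)"
  using assms unfolding sq_integrable_vec_def by (auto dest: spec[of _ \<omega>])

lemma sq_integrable_vec_add:
  assumes "sq_integrable_vec M n U" "sq_integrable_vec M n V"
  shows "sq_integrable_vec M n (\<lambda>\<omega>. U \<omega> + V \<omega>)"
  unfolding sq_integrable_vec_def
proof (intro conjI allI impI)
  fix i assume "i < n"
  then show "sq_integrable M (\<lambda>\<omega>. (U \<omega> + V \<omega>) $ i)"
    using sq_integrable_add[OF sq_integrable_vecD(3)[OF assms(1)] sq_integrable_vecD(3)[OF assms(2)]]
    by (simp add: sq_integrable_vecD(2)[OF assms(2)])
qed (use assms in \<open>auto simp: sq_integrable_vec_def\<close>)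

lemma mult_mat_vec_index:
  assumes "F \<in> carrier_mat n n" "u \<in> carrier_vec n" "i < n"
  shows "(F *\<^sub>v u) $ i = (\<Sum>k<n. F $$ (i, k) * u $ k)"
  using assms by (auto simp: scalar_prod_def lessThan_atLeast0 intro!: sum.cong)

lemma sq_integrable_vec_mult:
  assumes "F \<in> carrier_mat n n" "sq_integrable_vec M n U"
  shows "sq_integrable_vec M n (\<lambda>\<omega>. F *\<^sub>v U \<omega>)"
  unfolding sq_integrable_vec_def
proof (intro conjI allI impI)
  fix i assume "i < n"
  then have *: "(F *\<^sub>v U \<omega>) $ i = (\<Sum>k<n. F $$ (i, k) * U \<omega> $ k)" for \<omega>
    using assms mult_mat_vec_index unfolding sq_integrable_vec_def by blast
  show "sq_integrable M (\<lambda>\<omega>. (F *\<^sub>v U \<omega>) $ i)"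
    unfolding * using assms
    by (intro sq_integrable_sum sq_integrable_cmult) (auto simp: sq_integrable_vec_def)
qed (use assms in \<open>auto simp: sq_integrable_vec_def\<close>)

lemma sq_integrable_vec_conjugate:
  assumes "sq_integrable_vec M n U"
  shows "sq_integrable_vec M n (\<lambda>\<omega>. conjugate (U \<omega>))"
  unfolding sq_integrable_vec_def
proof (intro conjI allI impI)
  fix i assume "i < n"
  then show "sq_integrable M (\<lambda>\<omega>. conjugate (U \<omega>) $ i)"
    using sq_integrable_cnj[OF sq_integrable_vecD(3)[OF assms]]
    by (simp add: sq_integrable_vecD(2)[OF assms])
qed (use assms in \<open>auto simp: sq_integrable_vec_def\<close>)

text \<open>No conjugation is built in. The form is therefore bilinear, and both the covariance
  (second argument \<open>conjugate (V \<omega>)\<close>) and the pseudo-covariance are instances of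
  it; rules for the right argument follow from those for the left by transposition.\<close>

definition corr :: "'w measure \<Rightarrow> nat \<Rightarrow> ('w \<Rightarrow> complex vec) \<Rightarrow> ('w \<Rightarrow> complex vec) \<Rightarrow> complex mat" where
  "corr M n U V = expect_mat M n (\<lambda>\<omega>. outer (U \<omega>) (V \<omega>))"

lemma corr_carrier [simp]: "corr M n U V \<in> carrier_mat n n"
  by (simp add: corr_def expect_mat_def)

lemma dim_corr [simp]: "dim_row (corr M n U V) = n" "dim_col (corr M n U V) = n"
  by (simp_all add: corr_def expect_mat_def)

lemma corr_index:
  assumes "\<And>\<omega>. U \<omega> \<in> carrier_vec n" "\<And>\<omega>. V \<omega> \<in> carrier_vec n" "i < n" "k < n"
  shows "corr M n U V $$ (i, k) = integral\<^sup>L M (\<lambda>\<omega>. U \<omega> $ i * V \<omega> $ k)"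
proof -
  have "dim_vec (U \<omega>) = n" "dim_vec (V \<omega>) = n" for \<omega> using assms(1,2)[of \<omega>] by auto
  then show ?thesis using assms(3,4) by (simp add: corr_def expect_mat_def outer_def)
qed

lemma corr_transpose:
  assumes "\<And>\<omega>. U \<omega> \<in> carrier_vec n" "\<And>\<omega>. V \<omega> \<in> carrier_vec n"
  shows "corr M n V U = transpose_mat (corr M n U V)"
proof (rule eq_matI)
  fix i k assume "i < dim_row (transpose_mat (corr M n U V))"
    "k < dim_col (transpose_mat (corr M n U V))"
  then have ik: "i < n" "k < n" by simp_all
  then have "transpose_mat (corr M n U V) $$ (i, k) = corr M n U V $$ (k, i)"
    using corr_carrier[of M n U V] by auto
  then show "corr M n V U $$ (i, k) = transpose_mat (corr M n U V) $$ (i, k)"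
    using ik by (simp add: corr_index assms mult.commute)
qed simp_all

lemma corr_add_left:
  assumes "sq_integrable_vec M n U" "sq_integrable_vec M n V" "sq_integrable_vec M n W"
  shows "corr M n (\<lambda>\<omega>. U \<omega> + V \<omega>) W = corr M n U W + corr M n V W"
proof (rule eq_matI)
  have c: "U \<omega> \<in> carrier_vec n" "V \<omega> \<in> carrier_vec n" "W \<omega> \<in> carrier_vec n" for \<omega>
    using assms by (auto simp: sq_integrable_vec_def)
  fix i k assume "i < dim_row (corr M n U W + corr M n V W)" "k < dim_col (corr M n U W + corr M n V W)"
  then have ik: "i < n" "k < n" by simp_all
  have int: "integrable M (\<lambda>\<omega>. U \<omega> $ i * W \<omega> $ k)" "integrable M (\<lambda>\<omega>. V \<omega> $ i * W \<omega> $ k)"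
    using assms ik by (auto intro!: sq_integrable_mult simp: sq_integrable_vec_def)
  have "(U \<omega> + V \<omega>) $ i = U \<omega> $ i + V \<omega> $ i" for \<omega>
    using c[of \<omega>] ik by (intro index_add_vec(1)) auto
  then have "corr M n (\<lambda>\<omega>. U \<omega> + V \<omega>) W $$ (i, k)
      = integral\<^sup>L M (\<lambda>\<omega>. U \<omega> $ i * W \<omega> $ k + V \<omega> $ i * W \<omega> $ k)"
    using ik c by (subst corr_index) (auto simp: ring_distribs)
  also have "\<dots> = corr M n U W $$ (i, k) + corr M n V W $$ (i, k)"
    using ik c int by (subst Bochner_Integration.integral_add) (auto simp: corr_index)
  finally show "corr M n (\<lambda>\<omega>. U \<omega> + V \<omega>) W $$ (i, k) = (corr M n U W + corr M n V W) $$ (i, k)"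
    using ik by simp
qed (simp_all add: corr_def expect_mat_def)

lemma corr_mult_left:
  assumes "F \<in> carrier_mat n n" "sq_integrable_vec M n U" "sq_integrable_vec M n W"
  shows "corr M n (\<lambda>\<omega>. F *\<^sub>v U \<omega>) W = F * corr M n U W"
proof (rule eq_matI)
  have c: "U \<omega> \<in> carrier_vec n" "F *\<^sub>v U \<omega> \<in> carrier_vec n" "W \<omega> \<in> carrier_vec n" for \<omega>
    using assms by (auto simp: sq_integrable_vec_def)
  fix i k assume "i < dim_row (F * corr M n U W)" "k < dim_col (F * corr M n U W)"
  then have ik: "i < n" "k < n" using assms(1) by auto
  have int: "integrable M (\<lambda>\<omega>. U \<omega> $ l * W \<omega> $ k)" if "l < n" for l
    using assms ik that by (auto intro!: sq_integrable_mult simp: sq_integrable_vec_def)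
  have "corr M n (\<lambda>\<omega>. F *\<^sub>v U \<omega>) W $$ (i, k)
      = integral\<^sup>L M (\<lambda>\<omega>. \<Sum>l<n. F $$ (i, l) * (U \<omega> $ l * W \<omega> $ k))"
    using ik c
    by (subst corr_index)
      (auto simp: mult_mat_vec_index[OF assms(1)] sum_distrib_right mult.assoc simp del: index_mult_mat_vec)
  also have "\<dots> = (\<Sum>l<n. F $$ (i, l) * corr M n U W $$ (l, k))"
    using ik c int by (subst Bochner_Integration.integral_sum) (auto simp: corr_index)
  also have "\<dots> = (F * corr M n U W) $$ (i, k)"
    using ik assms(1)
    by (auto simp: scalar_prod_def lessThan_atLeast0 intro!: sum.cong)
  finally show "corr M n (\<lambda>\<omega>. F *\<^sub>v U \<omega>) W $$ (i, k) = (F * corr M n U W) $$ (i, k)" .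
qed (use assms in \<open>auto simp: corr_def expect_mat_def\<close>)

lemma corr_add_right:
  assumes "sq_integrable_vec M n U" "sq_integrable_vec M n V" "sq_integrable_vec M n W"
  shows "corr M n W (\<lambda>\<omega>. U \<omega> + V \<omega>) = corr M n W U + corr M n W V"
proof -
  have c: "U \<omega> \<in> carrier_vec n" "V \<omega> \<in> carrier_vec n" "W \<omega> \<in> carrier_vec n" for \<omega>
    using assms by (auto simp: sq_integrable_vec_def)
  show ?thesis
    using c by (simp add: corr_transpose[of "\<lambda>\<omega>. U \<omega> + V \<omega>" n W] corr_add_left assms
        corr_transpose[of U n W] corr_transpose[of V n W] transpose_add[of _ n n])
qed

lemma corr_mult_right:
  assumes "F \<in> carrier_mat n n" "sq_integrable_vec M n U" "sq_integrable_vec M n W"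
  shows "corr M n W (\<lambda>\<omega>. F *\<^sub>v U \<omega>) = corr M n W U * transpose_mat F"
proof -
  have c: "U \<omega> \<in> carrier_vec n" "F *\<^sub>v U \<omega> \<in> carrier_vec n" "W \<omega> \<in> carrier_vec n" for \<omega>
    using assms by (auto simp: sq_integrable_vec_def)
  show ?thesis
    using c by (simp add: corr_transpose[of "\<lambda>\<omega>. F *\<^sub>v U \<omega>" n W] corr_mult_left assms
        corr_transpose[of U n W] transpose_mult[OF assms(1) corr_carrier])
qed

lemma corr_conjugate:
  assumes "\<And>\<omega>. U \<omega> \<in> carrier_vec n" "\<And>\<omega>. V \<omega> \<in> carrier_vec n"
  shows "corr M n (\<lambda>\<omega>. conjugate (U \<omega>)) (\<lambda>\<omega>. conjugate (V \<omega>)) = map_mat cnj (corr M n U V)"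
proof (rule eq_matI)
  fix i k assume "i < dim_row (map_mat cnj (corr M n U V))"
    "k < dim_col (map_mat cnj (corr M n U V))"
  then have ik: "i < n" "k < n" by simp_all
  have d: "dim_vec (U \<omega>) = n" "dim_vec (V \<omega>) = n" for \<omega> using assms(1,2)[of \<omega>] by auto
  have "corr M n (\<lambda>\<omega>. conjugate (U \<omega>)) (\<lambda>\<omega>. conjugate (V \<omega>)) $$ (i, k)
     = integral\<^sup>L M (\<lambda>\<omega>. cnj (U \<omega> $ i * V \<omega> $ k))"
    using ik assms d by (subst corr_index) (simp_all add: d)
  also have "\<dots> = cnj (corr M n U V $$ (i, k))"
    using ik assms by (simp only: Bochner_Integration.integral_cnj corr_index)
  finally show "corr M n (\<lambda>\<omega>. conjugate (U \<omega>)) (\<lambda>\<omega>. conjugate (V \<omega>)) $$ (i, k)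
    = map_mat cnj (corr M n U V) $$ (i, k)"
    using ik by simp
qed (simp_all add: corr_def expect_mat_def)

section \<open>The normal equations of widely linear estimation\<close>

lemma mult_cancel_right_mat:
  fixes X Y G G' :: "'a :: comm_ring_1 mat"
  assumes "X \<in> carrier_mat n n" "Y \<in> carrier_mat n n" "G \<in> carrier_mat n n" "G' \<in> carrier_mat n n"
    and "G * G' = 1\<^sub>m n"
  shows "X * G = Y * G \<longleftrightarrow> X = Y"
proof
  assume "X * G = Y * G"
  then have "X * G * G' = Y * G * G'" by simp
  then show "X = Y" using assms by (simp add: assoc_mult_mat[of _ n n _ n _ n])
qed simp

text \<open>The displayed equations are the orthogonality conditions after the second moments of the
  observation are inserted. Only the involution \<open>B\<close>, right inverses of \<open>G\<close>
  and \<open>H\<close>, a two-sided inverse of \<open>K\<close> and \<open>s \<noteq> 0\<close>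
  enter, so no probability remains here. The equivalence carries both existence and uniqueness of
  the coefficients.\<close>

lemma widely_linear_normal_equations:
  fixes B C D G H K G' H' K' :: "complex mat"
  assumes carr: "B \<in> carrier_mat n n" "C \<in> carrier_mat n n" "D \<in> carrier_mat n n"
      "G \<in> carrier_mat n n" "H \<in> carrier_mat n n" "G' \<in> carrier_mat n n" "H' \<in> carrier_mat n n"
      "K' \<in> carrier_mat n n"
    and BB: "B * B = 1\<^sub>m n" and GG: "G * G' = 1\<^sub>m n" and HH: "H * H' = 1\<^sub>m n"
    and K: "K = G + B * H * B + s \<cdot>\<^sub>m 1\<^sub>m n" and KK: "K * K' = 1\<^sub>m n" "K' * K = 1\<^sub>m n"
    and s: "s \<noteq> 0"
  shows "G = C * (G * G + s \<cdot>\<^sub>m G) + D * (H * B * G)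
      \<and> B * H = C * (G * B * H) + D * (H * H + s \<cdot>\<^sub>m H)
    \<longleftrightarrow> C = K' \<and> D = K' * B"
proof -
  note ring = assoc_mult_mat[of _ n n _ n _ n] add_mult_distrib_mat[of _ n n _ _ n]
    mult_add_distrib_mat[of _ n n _ n _] mult_smult_distrib[of _ n n _ n] mult_smult_assoc_mat[of _ n n _ n]
    right_mult_one_mat[of _ n n] left_mult_one_mat[of _ n n] mult_carrier_mat[of _ n n _ n]
    add_carrier_mat[of _ n n] smult_carrier_mat[of _ n n]
  \<comment> \<open>Every term of the first equation ends in the factor \<open>G\<close>, and every
    term of the second in \<open>H\<close>, so these can be cancelled on the right. The third
    equivalence multiplies by \<open>B\<close> on the right, which is reversible since
    \<open>B\<close> is an involution.\<close>
  have 1: "G = C * (G * G + s \<cdot>\<^sub>m G) + D * (H * B * G) \<longleftrightarrow> 1\<^sub>m n = C * G + s \<cdot>\<^sub>m C + D * H * B"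
    using mult_cancel_right_mat[OF _ _ carr(4,6) GG, of "1\<^sub>m n" "C * G + s \<cdot>\<^sub>m C + D * H * B"] carr
    by (simp add: ring)
  have 2: "B * H = C * (G * B * H) + D * (H * H + s \<cdot>\<^sub>m H) \<longleftrightarrow> B = C * G * B + (D * H + s \<cdot>\<^sub>m D)"
    using mult_cancel_right_mat[OF _ _ carr(5,7) HH, of B "C * G * B + (D * H + s \<cdot>\<^sub>m D)"] carr
    by (simp add: ring)
  have 3: "B = C * G * B + (D * H + s \<cdot>\<^sub>m D) \<longleftrightarrow> 1\<^sub>m n = C * G + (D * H * B + s \<cdot>\<^sub>m (D * B))"
    using mult_cancel_right_mat[OF _ _ carr(1,1) BB, of B "C * G * B + (D * H + s \<cdot>\<^sub>m D)"] carr BB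
    by (simp add: ring)
  have K_carr: "K \<in> carrier_mat n n" using carr by (simp add: K)
  have KC: "C * K = C * G + C * B * H * B + s \<cdot>\<^sub>m C"
  proof -
    have "C * K = C * (G + B * H * B) + C * (s \<cdot>\<^sub>m 1\<^sub>m n)"
      unfolding K using carr by (intro mult_add_distrib_mat[of _ n n _ n]) simp_all
    then show ?thesis using carr by (simp add: ring)
  qed
  show ?thesis unfolding 1 2 3
  proof safe
    assume e: "1\<^sub>m n = C * G + s \<cdot>\<^sub>m C + D * H * B" "1\<^sub>m n = C * G + (D * H * B + s \<cdot>\<^sub>m (D * B))"
    \<comment> \<open>The two equations share the terms \<open>C * G\<close> and
      \<open>D * H * B\<close>; comparing them entrywise, with the matrix products kept as atoms,
      leaves only the noise terms.\<close>
    have "s \<cdot>\<^sub>m C = s \<cdot>\<^sub>m (D * B)"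
    proof (rule eq_matI)
      fix i j assume "i < dim_row (s \<cdot>\<^sub>m (D * B))" "j < dim_col (s \<cdot>\<^sub>m (D * B))"
      then have "i < n" "j < n" using carr by auto
      then show "(s \<cdot>\<^sub>m C) $$ (i, j) = (s \<cdot>\<^sub>m (D * B)) $$ (i, j)"
        using arg_cong[OF e(1), of "\<lambda>X. X $$ (i, j)"] arg_cong[OF e(2), of "\<lambda>X. X $$ (i, j)"] carr
        by (auto simp del: index_mult_mat(1))
    qed (use carr in auto)
    then have "inverse s \<cdot>\<^sub>m (s \<cdot>\<^sub>m C) = inverse s \<cdot>\<^sub>m (s \<cdot>\<^sub>m (D * B))" by simp
    then have CD: "C = D * B" using s carr
      by (auto simp: mat_eq_iff)
    then have DC: "D = C * B" using carr BB by (simp add: ring)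
    have "C * K = C * G + (C * B * H * B + s \<cdot>\<^sub>m C)"
      unfolding KC using carr by (intro assoc_add_mat[of _ n n]) (simp_all add: ring)
    also have "\<dots> = C * G + (s \<cdot>\<^sub>m C + C * B * H * B)"
      using carr comm_add_mat[of "C * B * H * B" n n "s \<cdot>\<^sub>m C"] by (simp add: ring)
    also have "\<dots> = 1\<^sub>m n"
      unfolding e(1) DC using carr by (intro assoc_add_mat[of _ n n, symmetric]) (simp_all add: ring)
    finally have "C * K = 1\<^sub>m n" .
    then have "C * K * K' = K'" using carr by simp
    then show "C = K'"
      unfolding assoc_mult_mat[OF carr(2) K_carr carr(8)] KK(1) using carr(2) by simp
    then show "D = K' * B" using DC by simp
  next
    assume CD: "C = K'" "D = K' * B"
    have "1\<^sub>m n = K' * G + K' * B * H * B + s \<cdot>\<^sub>m K'"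
      using KC KK(2) CD by simp
    moreover have "K' * B * B = K'" using carr BB by (simp add: ring)
    ultimately show "1\<^sub>m n = K' * G + s \<cdot>\<^sub>m K' + K' * B * H * B"
      "1\<^sub>m n = K' * G + (K' * B * H * B + s \<cdot>\<^sub>m (K' * B * B))"
      using carr by (simp_all add: ring comm_add_mat[of "s \<cdot>\<^sub>m K'" n n] assoc_add_mat[of _ n n])
  qed
qed

section \<open>Positive definiteness of the channel autocorrelation\<close>

text \<open>A nonzero kernel vector would make the sesquilinear form vanish at that vector, so the
  determinant is nonzero. Vectors are plain functions in the hypothesis so that the form can be
  handled as a double sum.\<close>

lemma inverse_mat_exists:
  fixes F :: "complex mat"
  assumes F: "F \<in> carrier_mat n n"
    and form: "\<And>z. (\<Sum>m<n. \<Sum>k<n. cnj (z m) * F $$ (m, k) * z k) = 0 \<Longrightarrow> \<forall>m<n. z m = 0"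
  obtains F' where "F' \<in> carrier_mat n n" "F * F' = 1\<^sub>m n" "F' * F = 1\<^sub>m n"
proof -
  have "det F \<noteq> 0"
  proof
    assume "det F = 0"
    then obtain z where z: "z \<in> carrier_vec n" "z \<noteq> 0\<^sub>v n" "F *\<^sub>v z = 0\<^sub>v n"
      using det_0_iff_vec_prod_zero_field[OF F] by auto
    have "(\<Sum>k<n. F $$ (m, k) * z $ k) = 0" if "m < n" for m
    proof -
      have "(\<Sum>k<n. F $$ (m, k) * z $ k) = (F *\<^sub>v z) $ m"
        using F z(1) that by (auto simp: scalar_prod_def lessThan_atLeast0 intro!: sum.cong)
      then show ?thesis using z(3) that by simp
    qed
    then have "(\<Sum>m<n. \<Sum>k<n. cnj (z $ m) * F $$ (m, k) * z $ k) = 0"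
      by (simp add: mult.assoc flip: sum_distrib_left)
    from form[OF this] show False using z(1,2) by (auto simp: vec_eq_iff)
  qed
  then have "F \<in> Units (ring_mat TYPE(complex) n ())" by (rule det_non_zero_imp_unit[OF F])
  then show thesis using that unfolding Units_def by (auto simp: ring_mat_simps)
qed

text \<open>The substitution \<open>l = p + k\<close> makes the summand a product of one factor in
  \<open>m\<close> and one in \<open>k\<close>. Its range still depends on \<open>k\<close>; since
  \<open>k < n\<close>, it lies in the common range from \<open>- int n\<close> to
  \<open>int L\<close>, and the added terms vanish because there \<open>p + k\<close> is outside the
  support of \<open>h\<close>. With a common range the sums can be interchanged.\<close>

lemma chan_autocorr_shift:
  assumes h: "\<forall>k. k < 0 \<or> k > int L \<longrightarrow> h k = 0" and k: "k < n"
  shows "chan_autocorr L h (int m - int k)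
    = (\<Sum>p\<in>{- int n..int L}. h (p + int m) * cnj (h (p + int k)))"
proof -
  have "chan_autocorr L h (int m - int k)
      = (\<Sum>p\<in>(\<lambda>l. l - int k) ` {0..int L}. h (p + int m) * cnj (h (p + int k)))"
    unfolding chan_autocorr_def
    by (subst sum.reindex) (auto simp: inj_on_def algebra_simps)
  also have "\<dots> = (\<Sum>p\<in>{- int n..int L}. h (p + int m) * cnj (h (p + int k)))"
  proof (rule sum.mono_neutral_left)
    show "\<forall>p\<in>{- int n..int L} - (\<lambda>l. l - int k) ` {0..int L}. h (p + int m) * cnj (h (p + int k)) = 0"
    proof
      fix p assume p: "p \<in> {- int n..int L} - (\<lambda>l. l - int k) ` {0..int L}"
      then have "p + int k \<notin> {0..int L}" by (auto simp: image_iff)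
      then have "h (p + int k) = 0" using h by auto
      then show "h (p + int m) * cnj (h (p + int k)) = 0" by simp
    qed
  qed (use k in auto)
  finally show ?thesis .
qed

text \<open>The autocorrelation matrix is a Gram matrix of shifted copies of the taps, so its
  quadratic form is the energy of a filtered sequence and in particular real and
  nonnegative.\<close>

lemma autocorr_quadratic_form:
  assumes h: "\<forall>k. k < 0 \<or> k > int L \<longrightarrow> h k = 0"
  shows "(\<Sum>m<n. \<Sum>k<n. cnj (z m) * chan_autocorr L h (int m - int k) * z k)
    = of_real (\<Sum>p\<in>{- int n..int L}. (cmod (\<Sum>m<n. cnj (z m) * h (p + int m)))\<^sup>2)"
proof -
  have "(\<Sum>m<n. \<Sum>k<n. cnj (z m) * chan_autocorr L h (int m - int k) * z k)
     = (\<Sum>m<n. \<Sum>k<n. \<Sum>p\<in>{- int n..int L}. (cnj (z m) * h (p + int m)) * cnj (cnj (z k) * h (p + int k)))"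
    by (intro sum.cong refl)
      (simp add: chan_autocorr_shift[OF h, of _ n] sum_distrib_left sum_distrib_right mult_ac)
  also have "\<dots> = (\<Sum>m<n. \<Sum>p\<in>{- int n..int L}. \<Sum>k<n. (cnj (z m) * h (p + int m)) * cnj (cnj (z k) * h (p + int k)))"
    by (intro sum.cong refl sum.swap)
  also have "\<dots> = (\<Sum>p\<in>{- int n..int L}. \<Sum>m<n. \<Sum>k<n. (cnj (z m) * h (p + int m)) * cnj (cnj (z k) * h (p + int k)))"
    by (rule sum.swap)
  also have "\<dots> = (\<Sum>p\<in>{- int n..int L}. (\<Sum>m<n. cnj (z m) * h (p + int m)) * cnj (\<Sum>m<n. cnj (z m) * h (p + int m)))"
    unfolding cnj_sum sum_product ..
  also have "\<dots> = of_real (\<Sum>p\<in>{- int n..int L}. (cmod (\<Sum>m<n. cnj (z m) * h (p + int m)))\<^sup>2)"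
    unfolding of_real_sum by (intro sum.cong refl) (simp only: complex_norm_square)
  finally show ?thesis .
qed

text \<open>The inner sums are the coefficients of a product of two Laurent polynomials, one with
  coefficients \<open>h\<close> and one with the conjugates of \<open>z\<close> at negated
  exponents. If both are nonzero, the top coefficient of the product is the product of the two top
  coefficients, so the energy cannot vanish.\<close>

lemma autocorr_form_pos_def:
  assumes h: "\<forall>k. k < 0 \<or> k > int L \<longrightarrow> h k = 0" and nz: "\<exists>k\<in>{0..int L}. h k \<noteq> 0"
    and zero: "(\<Sum>m<n. \<Sum>k<n. cnj (z m) * chan_autocorr L h (int m - int k) * z k) = 0"
  shows "\<forall>m<n. z m = 0"
proof (rule ccontr)
  assume "\<not> (\<forall>m<n. z m = 0)"
  then have ex: "\<exists>m. m < n \<and> z m \<noteq> 0" by blast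
  define m0 where "m0 = (LEAST m. m < n \<and> z m \<noteq> 0)"
  have m0: "m0 < n" "z m0 \<noteq> 0" using LeastI_ex[OF ex] by (auto simp: m0_def)
  have before: "z m = 0" if "m < m0" for m
    using not_less_Least[of m "\<lambda>m. m < n \<and> z m \<noteq> 0"] that m0(1) by (auto simp: m0_def)
  define S where "S = {k\<in>{0..int L}. h k \<noteq> 0}"
  have S: "finite S" "S \<noteq> {}"
    using nz by (auto simp: S_def intro: finite_subset[of _ "{0..int L}"])
  define q where "q = Max S"
  have q: "0 \<le> q" "q \<le> int L" "h q \<noteq> 0" using Max_in[OF S] by (auto simp: q_def S_def)
  have after: "h k = 0" if "k > q" for k
  proof (rule ccontr)
    assume hk: "h k \<noteq> 0"
    then have "k \<in> S" using spec[OF h, of k] by (force simp: S_def)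
    then show False using Max_ge[OF S(1), of k] that by (simp add: q_def)
  qed
  \<comment> \<open>At this shift only the first nonzero \<open>z\<close> meets the last nonzero tap.\<close>
  let ?p = "q - int m0"
  have "of_real (\<Sum>p\<in>{- int n..int L}. (cmod (\<Sum>m<n. cnj (z m) * h (p + int m)))\<^sup>2) = (0::complex)"
    using zero unfolding autocorr_quadratic_form[OF h] .
  then have "(\<Sum>p\<in>{- int n..int L}. (cmod (\<Sum>m<n. cnj (z m) * h (p + int m)))\<^sup>2) = 0"
    by (simp only: of_real_eq_0_iff)
  then have "\<forall>p\<in>{- int n..int L}. (cmod (\<Sum>m<n. cnj (z m) * h (p + int m)))\<^sup>2 = 0"
    by (subst (asm) sum_nonneg_eq_0_iff) simp_all
  moreover have "?p \<in> {- int n..int L}" using q m0(1) by auto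
  ultimately have "(\<Sum>m<n. cnj (z m) * h (?p + int m)) = 0" by fastforce
  moreover have "(\<Sum>m<n. cnj (z m) * h (?p + int m)) = (\<Sum>m<n. if m = m0 then cnj (z m0) * h q else 0)"
  proof (rule sum.cong)
    fix m
    show "cnj (z m) * h (?p + int m) = (if m = m0 then cnj (z m0) * h q else 0)"
      using before[of m] after[of "?p + int m"] by (cases m m0 rule: linorder_cases) auto
  qed simp
  ultimately show False using m0 q(3) by simp
qed

lemma Gamma_mat_inverse:
  assumes h: "\<forall>k. k < 0 \<or> k > int L \<longrightarrow> h k = 0" and nz: "\<exists>k\<in>{0..int L}. h k \<noteq> 0"
  obtains G' where "G' \<in> carrier_mat (2 * \<nu>) (2 * \<nu>)" "Gamma_mat \<nu> L h * G' = 1\<^sub>m (2 * \<nu>)"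
    "G' * Gamma_mat \<nu> L h = 1\<^sub>m (2 * \<nu>)"
proof (rule inverse_mat_exists)
  fix z :: "nat \<Rightarrow> complex"
  let ?n = "2 * \<nu>"
  have "(\<Sum>m<?n. \<Sum>k<?n. cnj (z m) * Gamma_mat \<nu> L h $$ (m, k) * z k)
      = (\<Sum>m<?n. \<Sum>k<?n. cnj (z m) * chan_autocorr L h (int m - int k) * z k)"
    by (intro sum.cong refl) (simp add: Gamma_mat_def)
  moreover assume "(\<Sum>m<?n. \<Sum>k<?n. cnj (z m) * Gamma_mat \<nu> L h $$ (m, k) * z k) = 0"
  ultimately show "\<forall>m<?n. z m = 0"
    by (intro autocorr_form_pos_def[OF h nz]) (rule trans[OF sym])
qed (auto simp: Gamma_mat_def)

section \<open>Definiteness of the widely linear Gram matrix\<close>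

definition wl_gram :: "nat \<Rightarrow> complex mat \<Rightarrow> complex \<Rightarrow> complex mat" where
  "wl_gram \<nu> G s = G + B_mat \<nu> * transpose_mat G * B_mat \<nu> + s \<cdot>\<^sub>m 1\<^sub>m (2 * \<nu>)"

lemma B_mat_carrier [simp]: "B_mat \<nu> \<in> carrier_mat (2 * \<nu>) (2 * \<nu>)"
  by (simp add: B_mat_def)

lemma A_mat_carrier [simp]: "A_mat \<nu> \<in> carrier_mat (2 * \<nu>) (2 * \<nu>)"
  by (simp add: A_mat_def)

lemma Gamma_mat_carrier [simp]: "Gamma_mat \<nu> L h \<in> carrier_mat (2 * \<nu>) (2 * \<nu>)"
  by (simp add: Gamma_mat_def)

text \<open>The quadratic form of \<open>K\<close> is a sum of two filter energies and
  \<open>\<sigma>2\<close> times the squared norm of \<open>z\<close>. All three are nonnegative,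
  and the last one alone forces \<open>z = 0\<close>.\<close>

lemma wl_gram_inverse:
  assumes h: "\<forall>k. k < 0 \<or> k > int L \<longrightarrow> h k = 0" and \<sigma>: "\<sigma>2 > 0"
  obtains K' where "K' \<in> carrier_mat (2 * \<nu>) (2 * \<nu>)"
    "wl_gram \<nu> (Gamma_mat \<nu> L h) (of_real \<sigma>2) * K' = 1\<^sub>m (2 * \<nu>)"
    "K' * wl_gram \<nu> (Gamma_mat \<nu> L h) (of_real \<sigma>2) = 1\<^sub>m (2 * \<nu>)"
proof (rule inverse_mat_exists)
  let ?n = "2 * \<nu>" and ?K = "wl_gram \<nu> (Gamma_mat \<nu> L h) (of_real \<sigma>2)"
  let ?g = "chan_autocorr L h" and ?b = "\<lambda>m::nat. if even m then 1 else - 1 :: complex"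
  show "?K \<in> carrier_mat ?n ?n"
    by (auto simp: wl_gram_def)
  fix z :: "nat \<Rightarrow> complex"
  \<comment> \<open>For this \<open>w\<close>, the form of \<open>B * H * B\<close> at
    \<open>z\<close> is the form of \<open>G\<close> at \<open>w\<close> with the two summation
    indices exchanged, because \<open>H\<close> is the transpose of \<open>G\<close>.\<close>
  define w where "w m = ?b m * cnj (z m)" for m
  have K: "?K $$ (m, k) = ?g (int m - int k) + ?b m * ?g (int k - int m) * ?b k
      + (if m = k then of_real \<sigma>2 else 0)" if "m < ?n" "k < ?n" for m k
    using that unfolding wl_gram_def B_mat_def
    by (simp add: mat_diag_mult_left[of _ ?n ?n] mat_diag_mult_right[of _ ?n] Gamma_mat_def)
  have "cnj (z m) * ?K $$ (m, k) * z k = cnj (z m) * ?g (int m - int k) * z k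
      + cnj (w k) * ?g (int k - int m) * w m
      + (if m = k then of_real (\<sigma>2 * (cmod (z k))\<^sup>2) else 0)" if "m < ?n" "k < ?n" for m k
    unfolding K[OF that] w_def
    by (simp add: complex_norm_square algebra_simps del: of_real_power)
  then have "(\<Sum>m<?n. \<Sum>k<?n. cnj (z m) * ?K $$ (m, k) * z k)
      = (\<Sum>m<?n. \<Sum>k<?n. cnj (z m) * ?g (int m - int k) * z k)
      + (\<Sum>m<?n. \<Sum>k<?n. cnj (w k) * ?g (int k - int m) * w m)
      + (\<Sum>m<?n. \<Sum>k<?n. if m = k then of_real (\<sigma>2 * (cmod (z k))\<^sup>2) else 0)"
    by (simp add: sum.distrib)
  also have "(\<Sum>m<?n. \<Sum>k<?n. cnj (w k) * ?g (int k - int m) * w m)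
      = (\<Sum>k<?n. \<Sum>m<?n. cnj (w k) * ?g (int k - int m) * w m)" by (rule sum.swap)
  finally have form: "(\<Sum>m<?n. \<Sum>k<?n. cnj (z m) * ?K $$ (m, k) * z k)
      = of_real ((\<Sum>p\<in>{- int ?n..int L}. (cmod (\<Sum>m<?n. cnj (z m) * h (p + int m)))\<^sup>2)
      + (\<Sum>p\<in>{- int ?n..int L}. (cmod (\<Sum>m<?n. cnj (w m) * h (p + int m)))\<^sup>2)
      + (\<Sum>m<?n. \<sigma>2 * (cmod (z m))\<^sup>2))"
    unfolding autocorr_quadratic_form[OF h] by simp
  assume "(\<Sum>m<?n. \<Sum>k<?n. cnj (z m) * ?K $$ (m, k) * z k) = 0"
  then have "(\<Sum>p\<in>{- int ?n..int L}. (cmod (\<Sum>m<?n. cnj (z m) * h (p + int m)))\<^sup>2)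
      + (\<Sum>p\<in>{- int ?n..int L}. (cmod (\<Sum>m<?n. cnj (w m) * h (p + int m)))\<^sup>2)
      + (\<Sum>m<?n. \<sigma>2 * (cmod (z m))\<^sup>2) = 0" (is "?s1 + ?s2 + ?s3 = 0")
    unfolding form by (simp only: of_real_eq_0_iff)
  moreover have "?s1 \<ge> 0" "?s2 \<ge> 0" "?s3 \<ge> 0" using \<sigma> by (auto intro!: sum_nonneg)
  ultimately have "?s3 = 0" by linarith
  then have "\<forall>m\<in>{..<?n}. \<sigma>2 * (cmod (z m))\<^sup>2 = 0"
    using \<sigma> by (subst (asm) sum_nonneg_eq_0_iff) auto
  then show "\<forall>m<?n. z m = 0" using \<sigma> by auto
qed

section \<open>Moments of the OQAM signal and the noise\<close>

text \<open>The alphabet consists of the odd multiples in \<open>J\<close> and their negatives: the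
  pairing kills the mean and doubles the sum of squares. Evenness of \<open>N\<close> makes
  \<open>J\<close> have \<open>N / 2\<close> elements, so the mean square is exactly the expression
  normalized to 1 in the signal model.\<close>

lemma pam_symbols_moments:
  assumes amp: "amp > 0" and N: "even N" "N > 0"
  shows "finite (pam_symbols amp N)" "pam_symbols amp N \<noteq> {}"
    "\<Sum>(pam_symbols amp N) = 0"
    "(\<Sum>s\<in>pam_symbols amp N. s\<^sup>2) / card (pam_symbols amp N)
      = 2 * amp\<^sup>2 / real N * (\<Sum>i\<in>{i\<in>{1..N - 1}. odd i}. (real i)\<^sup>2)"
proof -
  define J where "J = {i\<in>{1..N - 1}. odd i}"
  define I where "I = {i::int. odd i \<and> \<bar>i\<bar> \<le> int N - 1}"
  have S: "pam_symbols amp N = (\<lambda>i. of_int i * amp) ` I"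
    by (auto simp: pam_symbols_def I_def)
  have inj: "inj_on (\<lambda>i. of_int i * amp) I" using amp by (auto simp: inj_on_def)
  have I: "I = int ` J \<union> (\<lambda>j. - int j) ` J"
  proof (intro Set.set_eqI iffI)
    fix i assume "i \<in> I"
    then have i: "odd i" "\<bar>i\<bar> \<le> int N - 1" by (auto simp: I_def)
    then have "i \<noteq> 0" by auto
    then have "nat \<bar>i\<bar> \<in> J" using i by (auto simp: J_def even_nat_iff)
    moreover have "i = int (nat \<bar>i\<bar>) \<or> i = - int (nat \<bar>i\<bar>)" by auto
    ultimately show "i \<in> int ` J \<union> (\<lambda>j. - int j) ` J" by blast
  qed (use N in \<open>auto simp: I_def J_def\<close>)
  have finJ: "finite J" by (simp add: J_def)
  have disj: "int ` J \<inter> (\<lambda>j. - int j) ` J = {}" by (auto simp: J_def)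
  have inj': "inj_on int J" "inj_on (\<lambda>j. - int j) J" by (auto simp: inj_on_def)
  obtain m where m: "N = 2 * m" using N by blast
  have "J = (\<lambda>j. 2 * j + 1) ` {..<m}"
    using N by (auto simp: J_def m image_iff elim!: oddE)
  then have cardJ: "card J = m" by (simp add: card_image inj_on_def)
  have cardI: "card I = N"
    unfolding I using disj finJ inj' by (subst card_Un_disjoint) (simp_all add: card_image cardJ m)
  show "finite (pam_symbols amp N)" unfolding S I using finJ by simp
  have "I \<noteq> {}" using cardI N by auto
  then show "pam_symbols amp N \<noteq> {}" unfolding S by simp
  have sumI: "(\<Sum>i\<in>I. f i) = (\<Sum>j\<in>J. f (int j) + f (- int j))" for f :: "int \<Rightarrow> real"
    unfolding I using disj finJ inj'
    by (subst sum.union_disjoint) (simp_all add: sum.reindex sum.distrib)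
  show "\<Sum>(pam_symbols amp N) = 0"
    unfolding S sum.reindex[OF inj] by (simp add: sumI)
  have "(\<Sum>s\<in>pam_symbols amp N. s\<^sup>2) = 2 * amp\<^sup>2 * (\<Sum>j\<in>J. (real j)\<^sup>2)"
    unfolding S sum.reindex[OF inj] by (simp add: sumI power_mult_distrib sum_distrib_left mult_ac)
  moreover have "card (pam_symbols amp N) = N" unfolding S using inj cardI by (simp add: card_image)
  ultimately show "(\<Sum>s\<in>pam_symbols amp N. s\<^sup>2) / card (pam_symbols amp N)
      = 2 * amp\<^sup>2 / real N * (\<Sum>i\<in>{i\<in>{1..N - 1}. odd i}. (real i)\<^sup>2)"
    by (simp add: J_def)
qed

section \<open>Expectations of uniform and Gaussian variables\<close>

lemma uniform_rv_expectation:
  fixes f :: "real \<Rightarrow> real"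
  assumes X: "uniform_rv M S X" and S: "finite S" "S \<noteq> {}" and f: "f \<in> borel_measurable borel"
  shows "integrable M (\<lambda>\<omega>. f (X \<omega>))" "integral\<^sup>L M (\<lambda>\<omega>. f (X \<omega>)) = (\<Sum>s\<in>S. f s) / card S"
proof -
  have meas: "X \<in> borel_measurable M"
    and d: "distr M borel X = distr (measure_pmf (pmf_of_set S)) borel (\<lambda>s. s)"
    using X by (auto simp: uniform_rv_def)
  have "integrable (measure_pmf (pmf_of_set S)) f"
    using S by (intro integrable_measure_pmf_finite) simp
  then have "integrable (distr M borel X) f"
    unfolding d using f by (simp add: integrable_distr_eq)
  then show "integrable M (\<lambda>\<omega>. f (X \<omega>))"
    using meas f by (simp add: integrable_distr_eq)
  have "integral\<^sup>L M (\<lambda>\<omega>. f (X \<omega>)) = integral\<^sup>L (distr M borel X) f"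
    using meas f by (simp add: integral_distr)
  also have "\<dots> = integral\<^sup>L (measure_pmf (pmf_of_set S)) f"
    unfolding d using f by (simp add: integral_distr)
  finally show "integral\<^sup>L M (\<lambda>\<omega>. f (X \<omega>)) = (\<Sum>s\<in>S. f s) / card S"
    using S by (simp add: integral_pmf_of_set)
qed

text \<open>Gaussianity is the source of the square integrability of the noise. Point masses have no
  density and are treated separately.\<close>

lemma (in prob_space) gaussian_rv_square_integrable:
  assumes "gaussian_rv M X"
  shows "integrable M (\<lambda>\<omega>. (X \<omega>)\<^sup>2)"
  using assms unfolding gaussian_rv_def
proof (elim conjE disjE exE)
  fix \<mu> assume meas: "X \<in> borel_measurable M" and "AE \<omega> in M. X \<omega> = \<mu>"
  then have "AE \<omega> in M. (X \<omega>)\<^sup>2 = \<mu>\<^sup>2" by auto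
  then show ?thesis
    using meas by (subst integrable_cong_AE[of _ _ "\<lambda>_. \<mu>\<^sup>2"]) auto
next
  fix \<mu> s :: real
  assume s: "s > 0" and D: "distributed M lborel X (\<lambda>t. ennreal (normal_density \<mu> s t))"
  \<comment> \<open>The known moments are centred at \<mu>, so \<open>x\<^sup>2\<close> is expanded
    around \<mu> into centred moments of order 2, 1 and 0.\<close>
  have "integrable lborel (\<lambda>x. normal_density \<mu> s x * (x - \<mu>)\<^sup>2
      + 2 * \<mu> * (normal_density \<mu> s x * (x - \<mu>)) + \<mu>\<^sup>2 * normal_density \<mu> s x)"
    using integrable_normal_moment[OF s, of \<mu> 2] integrable_normal_moment[OF s, of \<mu> 1]
      integrable_normal_moment[OF s, of \<mu> 0] by auto
  then have "integrable lborel (\<lambda>x. normal_density \<mu> s x * x\<^sup>2)"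
    by (rule Bochner_Integration.integrable_cong[THEN iffD1, rotated -1])
      (auto simp: power2_eq_square algebra_simps)
  then show ?thesis
    using distributed_integrable[OF D, of "\<lambda>x. x\<^sup>2"] by simp
qed

lemma (in prob_space) complex_gaussian_vec_sq_integrable:
  assumes v: "complex_gaussian_vec M n v"
  shows "sq_integrable_vec M n (rvec n v)"
  unfolding sq_integrable_vec_def
proof (intro conjI allI impI)
  fix i assume i: "i < n"
  \<comment> \<open>Joint Gaussianity is tested on a coefficient family supported at
    \<open>i\<close>. The choices \<open>c = 1\<close> and \<open>c = - \<i>\<close> then give the
    real and the imaginary part of \<open>v i\<close>.\<close>
  have "gaussian_rv M (\<lambda>\<omega>. Re (\<Sum>j<n. (if j = i then c else 0) * v j \<omega>))" for c
    using v unfolding complex_gaussian_vec_def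
    by (elim conjE allE[of _ "\<lambda>j. if j = i then c else 0"])
  then have c: "gaussian_rv M (\<lambda>\<omega>. Re (c * v i \<omega>))" for c
    using i by (simp add: if_distrib[of "\<lambda>t. t * _"] cong: if_cong)
  have "integrable M (\<lambda>\<omega>. (Re (1 * v i \<omega>))\<^sup>2 + (Re (- \<i> * v i \<omega>))\<^sup>2)"
    by (intro Bochner_Integration.integrable_add gaussian_rv_square_integrable c)
  then have "integrable M (\<lambda>\<omega>. (cmod (v i \<omega>))\<^sup>2)" by (simp add: cmod_power2)
  moreover have "v i \<in> borel_measurable M" using v i by (simp add: complex_gaussian_vec_def)
  ultimately show "sq_integrable M (\<lambda>\<omega>. rvec n v \<omega> $ i)"
    using i by (simp add: sq_integrable_def rvec_def)
qed (simp add: rvec_def)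

lemma (in prob_space) sq_integrable_imp_integrable:
  "sq_integrable M f \<Longrightarrow> integrable M f"
  using sq_integrable_mult[of M f "\<lambda>_. 1"] by (simp add: sq_integrable_def)

text \<open>Independence of the whole vectors descends to any pair of entries by composing with
  coordinate projections, after which the expectation of the product factors.\<close>

lemma (in prob_space) corr_indep_zero_mean:
  fixes X V :: "nat \<Rightarrow> 'a \<Rightarrow> complex"
  assumes indep: "indep_var (PiM {..<n} (\<lambda>_. borel)) (rfun n X) (PiM {..<n} (\<lambda>_. borel)) (rfun n V)"
    and X: "sq_integrable_vec M n (rvec n X)" and V: "sq_integrable_vec M n (rvec n V)"
    and mean: "\<And>i. i < n \<Longrightarrow> integral\<^sup>L M (V i) = 0"
  shows "corr M n (rvec n X) (rvec n V) = 0\<^sub>m n n"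
proof (rule eq_matI)
  fix i k assume "i < dim_row (0\<^sub>m n n :: complex mat)" "k < dim_col (0\<^sub>m n n :: complex mat)"
  then have ik: "i < n" "k < n" by auto
  have "indep_var borel ((\<lambda>f. f i) \<circ> rfun n X) borel ((\<lambda>f. f k) \<circ> rfun n V)"
    using ik by (intro indep_var_compose[OF indep] measurable_component_singleton) auto
  then have "indep_var borel (X i) borel (V k)"
    using ik by (simp add: o_def rfun_def)
  moreover have "integrable M (X i)" "integrable M (V k)"
    using sq_integrable_vecD(3)[OF X ik(1)] sq_integrable_vecD(3)[OF V ik(2)] ik
    by (auto simp: rvec_def intro: sq_integrable_imp_integrable)
  ultimately have "integral\<^sup>L M (\<lambda>\<omega>. X i \<omega> * V k \<omega>) = 0"
    using mean[OF ik(2)] by (simp add: indep_var_lebesgue_integral)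
  then show "corr M n (rvec n X) (rvec n V) $$ (i, k) = 0\<^sub>m n n $$ (i, k)"
    using ik by (subst corr_index) (auto simp: rvec_def)
qed simp_all

text \<open>The amplitudes are uncorrelated with unit variance, so only the phases matter: without
  conjugation the factor \<open>\<i>\<close> on odd entries is squared to -1. The nonzero
  pseudo-covariance \<open>B\<close> is the impropriety that widely linear processing
  exploits.\<close>

lemma (in prob_space) oqam_moments:
  assumes amp: "amp > 0" and N: "even N" "N > 0"
    and energy: "2 * amp\<^sup>2 / real N * (\<Sum>i\<in>{i\<in>{1..N - 1}. odd i}. (real i)\<^sup>2) = 1"
    and indep: "indep_vars (\<lambda>_. borel) a {..<2 * \<nu>}"
    and unif: "\<forall>n<2 * \<nu>. uniform_rv M (pam_symbols amp N) (a n)"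
  shows "sq_integrable_vec M (2 * \<nu>) (rvec (2 * \<nu>) (oqam a))"
    and "corr M (2 * \<nu>) (rvec (2 * \<nu>) (oqam a)) (rvec (2 * \<nu>) (oqam a)) = B_mat \<nu>"
proof -
  let ?n = "2 * \<nu>" and ?c = "\<lambda>n::nat. if even n then 1 else \<i>"
  note S = pam_symbols_moments[OF amp N]
  have oqam: "oqam a n \<omega> = ?c n * of_real (a n \<omega>)" for n \<omega> by (simp add: oqam_def)
  have meas: "a i \<in> borel_measurable M" if "i < ?n" for i
    using unif that by (simp add: uniform_rv_def)
  have mean: "integrable M (a i)" "integral\<^sup>L M (a i) = 0" if "i < ?n" for i
    using uniform_rv_expectation[OF unif[rule_format, OF that] S(1,2), of "\<lambda>x. x"] S(3) by auto
  have var: "integrable M (\<lambda>\<omega>. (a i \<omega>)\<^sup>2)" "integral\<^sup>L M (\<lambda>\<omega>. (a i \<omega>)\<^sup>2) = 1" if "i < ?n" for i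
    using uniform_rv_expectation[OF unif[rule_format, OF that] S(1,2), of "\<lambda>x. x\<^sup>2"] S(4) energy by auto
  have cov: "integral\<^sup>L M (\<lambda>\<omega>. a i \<omega> * a k \<omega>) = (if i = k then 1 else 0)" if "i < ?n" "k < ?n" for i k
  proof (cases "i = k")
    case True
    then show ?thesis using var(2)[OF that(1)] by (simp add: power2_eq_square)
  next
    case False
    have "indep_vars (\<lambda>_. borel) a {i, k}"
      using that by (intro indep_vars_subset[OF indep]) auto
    then have "integral\<^sup>L M (\<lambda>\<omega>. \<Prod>j\<in>{i, k}. a j \<omega>) = (\<Prod>j\<in>{i, k}. integral\<^sup>L M (a j))"
      using that mean(1) by (intro indep_vars_lebesgue_integral) auto
    then show ?thesis using False mean(2) that by simp
  qed
  show "sq_integrable_vec M ?n (rvec ?n (oqam a))"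
    unfolding sq_integrable_vec_def
  proof (intro conjI allI impI)
    fix i assume "i < ?n"
    then have "sq_integrable M (\<lambda>\<omega>. of_real (a i \<omega>))"
      using var(1) meas by (simp add: sq_integrable_def)
    then show "sq_integrable M (\<lambda>\<omega>. rvec ?n (oqam a) \<omega> $ i)"
      using \<open>i < ?n\<close> by (simp add: rvec_def oqam sq_integrable_cmult)
  qed (simp add: rvec_def)
  show "corr M ?n (rvec ?n (oqam a)) (rvec ?n (oqam a)) = B_mat \<nu>"
  proof (rule eq_matI)
    fix i k assume "i < dim_row (B_mat \<nu>)" "k < dim_col (B_mat \<nu>)"
    then have ik: "i < ?n" "k < ?n" by (auto simp: B_mat_def mat_diag_def)
    have "corr M ?n (rvec ?n (oqam a)) (rvec ?n (oqam a)) $$ (i, k)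
        = integral\<^sup>L M (\<lambda>\<omega>. (?c i * ?c k) * of_real (a i \<omega> * a k \<omega>))"
      using ik by (subst corr_index) (auto simp: rvec_def oqam mult_ac)
    also have "\<dots> = (?c i * ?c k) * of_real (if i = k then 1 else 0)"
      unfolding cov[OF ik, symmetric] by (simp only: integral_mult_right_zero integral_complex_of_real)
    also have "\<dots> = B_mat \<nu> $$ (i, k)" using ik by (simp add: B_mat_def mat_diag_def)
    finally show "corr M ?n (rvec ?n (oqam a)) (rvec ?n (oqam a)) $$ (i, k) = B_mat \<nu> $$ (i, k)" .
  qed (simp_all add: B_mat_def mat_diag_def)
qed

section \<open>The two equalizers\<close>

lemma conjugate_mult_mat_vec:
  fixes F :: "complex mat"
  assumes "F \<in> carrier_mat n n" "u \<in> carrier_vec n"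
  shows "conjugate (F *\<^sub>v u) = map_mat cnj F *\<^sub>v conjugate u"
proof (rule eq_vecI)
  fix i assume "i < dim_vec (map_mat cnj F *\<^sub>v conjugate u)"
  then have i: "i < n" using assms by simp
  then show "conjugate (F *\<^sub>v u) $ i = (map_mat cnj F *\<^sub>v conjugate u) $ i"
    using assms by (auto simp: scalar_prod_def intro!: sum.cong)
qed (use assms in auto)

lemma map_mat_cnj_mult:
  assumes "F \<in> carrier_mat n n" "G \<in> carrier_mat n n"
  shows "map_mat cnj (F * G) = map_mat cnj F * map_mat cnj G"
  using assms by (auto simp: scalar_prod_def intro!: eq_matI sum.cong)

lemma smult_mult_mat_vec:
  fixes F :: "'a :: comm_ring_1 mat"
  assumes "F \<in> carrier_mat n n" "u \<in> carrier_vec n"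
  shows "(k \<cdot>\<^sub>m F) *\<^sub>v u = k \<cdot>\<^sub>v (F *\<^sub>v u)"
  using assms by (auto simp: scalar_prod_def sum_distrib_left mult.assoc intro!: eq_vecI)

lemma smult_smult_mat:
  fixes F :: "'a :: comm_ring_1 mat"
  shows "k \<cdot>\<^sub>m (l \<cdot>\<^sub>m F) = (k * l) \<cdot>\<^sub>m F"
  by (auto intro!: eq_matI)

text \<open>The second orthogonality condition is the entrywise conjugate of the vanishing of the
  unconjugated correlation of the error with \<open>Y\<close>. Both conditions thus become linear in
  \<open>C\<close> and \<open>D\<close>, one for each of the regressors \<open>Z\<close> and
  \<open>Y\<close>.\<close>

lemma orthogonality_iff_corr:
  assumes X: "sq_integrable_vec M n X" and Y: "sq_integrable_vec M n Y"
    and C: "C \<in> carrier_mat n n" and D: "D \<in> carrier_mat n n"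
  defines "Z \<equiv> \<lambda>\<omega>. conjugate (Y \<omega>)"
  shows "orthogonality M n X Y C D \<longleftrightarrow>
    corr M n X Z = C * corr M n Y Z + D * corr M n Z Z \<and>
    corr M n X Y = C * corr M n Y Y + D * corr M n Z Y"
proof -
  have Z: "sq_integrable_vec M n Z" unfolding Z_def by (rule sq_integrable_vec_conjugate[OF Y])
  define W where "W \<omega> = widely_linear C D (Y \<omega>)" for \<omega>
  have W: "sq_integrable_vec M n W"
    unfolding W_def widely_linear_def Z_def[symmetric]
    by (intro sq_integrable_vec_add sq_integrable_vec_mult C D Y Z[unfolded Z_def])
  \<comment> \<open>The difference is written as a sum with a matrix multiple, so that closure under
    sums and matrix products suffices.\<close>
  have "sq_integrable_vec M n (\<lambda>\<omega>. X \<omega> + (- 1 \<cdot>\<^sub>m 1\<^sub>m n) *\<^sub>v W \<omega>)"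
    by (intro sq_integrable_vec_add sq_integrable_vec_mult X W) simp
  moreover have "X \<omega> + (- 1 \<cdot>\<^sub>m 1\<^sub>m n) *\<^sub>v W \<omega> = X \<omega> - W \<omega>" for \<omega>
    using sq_integrable_vecD(1)[OF X, of \<omega>] sq_integrable_vecD(1)[OF W, of \<omega>]
    by (auto simp: smult_mult_mat_vec[of _ n] intro!: eq_vecI)
  ultimately have E: "sq_integrable_vec M n (\<lambda>\<omega>. X \<omega> - W \<omega>)" by simp
  \<comment> \<open>With \<open>X\<close> split as error plus estimate, additivity alone separates
    the correlation of the error.\<close>
  have X_eq: "X = (\<lambda>\<omega>. (X \<omega> - W \<omega>) + W \<omega>)"
  proof
    fix \<omega> show "X \<omega> = (X \<omega> - W \<omega>) + W \<omega>"
      using sq_integrable_vecD(1)[OF X, of \<omega>] sq_integrable_vecD(1)[OF W, of \<omega>] by (auto intro!: eq_vecI)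
  qed
  have split: "corr M n (\<lambda>\<omega>. X \<omega> - W \<omega>) U = 0\<^sub>m n n
      \<longleftrightarrow> corr M n X U = C * corr M n Y U + D * corr M n Z U" if U: "sq_integrable_vec M n U" for U
  proof -
    have "corr M n X U = corr M n (\<lambda>\<omega>. X \<omega> - W \<omega>) U + corr M n W U"
      by (subst X_eq) (rule corr_add_left[OF E W U])
    moreover have "corr M n W U = C * corr M n Y U + D * corr M n Z U"
      unfolding W_def widely_linear_def Z_def[symmetric]
      using Y Z U C D by (simp add: Z_def corr_add_left corr_mult_left sq_integrable_vec_mult)
    moreover have "P = 0\<^sub>m n n \<longleftrightarrow> P + R = R"
      if "P \<in> carrier_mat n n" "R \<in> carrier_mat n n" for P R :: "complex mat"
      using that by (auto simp: mat_eq_iff)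
    from this[of "corr M n (\<lambda>\<omega>. X \<omega> - W \<omega>) U" "corr M n W U"]
    have "corr M n (\<lambda>\<omega>. X \<omega> - W \<omega>) U = 0\<^sub>m n n
        \<longleftrightarrow> corr M n (\<lambda>\<omega>. X \<omega> - W \<omega>) U + corr M n W U = corr M n W U" by simp
    ultimately show ?thesis by simp
  qed
  have "expect_mat M n (\<lambda>\<omega>. outer (conjugate (X \<omega> - W \<omega>)) (conjugate (Y \<omega>)))
      = map_mat cnj (corr M n (\<lambda>\<omega>. X \<omega> - W \<omega>) Y)"
    using corr_conjugate[OF sq_integrable_vecD(1)[OF E] sq_integrable_vecD(1)[OF Y]] unfolding corr_def .
  moreover have "map_mat cnj P = 0\<^sub>m n n \<longleftrightarrow> P = 0\<^sub>m n n" if "P \<in> carrier_mat n n" for P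
    using that by (auto simp: mat_eq_iff)
  ultimately have conj: "expect_mat M n (\<lambda>\<omega>. outer (conjugate (X \<omega> - W \<omega>)) (conjugate (Y \<omega>))) = 0\<^sub>m n n
      \<longleftrightarrow> corr M n (\<lambda>\<omega>. X \<omega> - W \<omega>) Y = 0\<^sub>m n n" by simp
  have plain: "expect_mat M n (\<lambda>\<omega>. outer (X \<omega> - W \<omega>) (conjugate (Y \<omega>)))
      = corr M n (\<lambda>\<omega>. X \<omega> - W \<omega>) Z" by (simp add: corr_def Z_def)
  show ?thesis
    unfolding orthogonality_def W_def[symmetric] conj plain split[OF Y] split[OF Z] ..
qed

text \<open>Because conjugating \<open>X\<close> is multiplication by \<open>B\<close>, the
  conjugate observation is again linear in \<open>X\<close>, with matrix \<open>H * B\<close>, plus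
  conjugate noise. All moments of \<open>Y\<close> and \<open>Z\<close> therefore reduce to those of
  signal and noise.\<close>

lemma observation_moments:
  fixes B G H :: "complex mat" and X V :: "'w \<Rightarrow> complex vec" and s :: real
  assumes X: "sq_integrable_vec M n X" and V: "sq_integrable_vec M n V"
    and G: "G \<in> carrier_mat n n" and H: "transpose_mat G = H" "map_mat cnj G = H"
    and B: "B \<in> carrier_mat n n" "transpose_mat B = B" "B * B = 1\<^sub>m n"
    and conj_X: "\<And>\<omega>. conjugate (X \<omega>) = B *\<^sub>v X \<omega>"
    and XX: "corr M n X X = B" and XV: "corr M n X V = 0\<^sub>m n n"
    and VV': "corr M n V (\<lambda>\<omega>. conjugate (V \<omega>)) = of_real s \<cdot>\<^sub>m G"
    and VV: "corr M n V V = 0\<^sub>m n n"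
  defines "Y \<equiv> \<lambda>\<omega>. G *\<^sub>v X \<omega> + V \<omega>"
  defines "Z \<equiv> \<lambda>\<omega>. conjugate (Y \<omega>)"
  shows "sq_integrable_vec M n Y"
    and "corr M n X Y = B * H" and "corr M n X Z = G"
    and "corr M n Y Y = G * B * H" and "corr M n Y Z = G * G + of_real s \<cdot>\<^sub>m G"
    and "corr M n Z Z = H * B * G" and "corr M n Z Y = H * H + of_real s \<cdot>\<^sub>m H"
proof -
  define V' where "V' \<omega> = conjugate (V \<omega>)" for \<omega>
  have V': "sq_integrable_vec M n V'" unfolding V'_def by (rule sq_integrable_vec_conjugate[OF V])
  note Xc = sq_integrable_vecD(1)[OF X] and Vc = sq_integrable_vecD(1)[OF V]
    and V'c = sq_integrable_vecD(1)[OF V']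
  have Hc: "H \<in> carrier_mat n n" using H G by auto
  have HT: "transpose_mat H = G" using H(1) by auto
  have HB: "H * B \<in> carrier_mat n n" using Hc B by simp
  have HBT: "transpose_mat (H * B) = B * G" using transpose_mult[OF Hc B(1)] B(2) HT by simp
  have GX: "sq_integrable_vec M n (\<lambda>\<omega>. G *\<^sub>v X \<omega>)" by (rule sq_integrable_vec_mult[OF G X])
  have BX: "sq_integrable_vec M n (\<lambda>\<omega>. (H * B) *\<^sub>v X \<omega>)" by (rule sq_integrable_vec_mult[OF HB X])
  show Y: "sq_integrable_vec M n Y" unfolding Y_def by (rule sq_integrable_vec_add[OF GX V])
  have Z: "sq_integrable_vec M n Z" unfolding Z_def by (rule sq_integrable_vec_conjugate[OF Y])
  have Z_eq: "Z = (\<lambda>\<omega>. (H * B) *\<^sub>v X \<omega> + V' \<omega>)"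
  proof
    fix \<omega>
    have "Z \<omega> = conjugate (G *\<^sub>v X \<omega>) + V' \<omega>"
      unfolding Z_def Y_def V'_def using G Xc Vc by (intro conjugate_add_vec[of _ n]) auto
    then show "Z \<omega> = (H * B) *\<^sub>v X \<omega> + V' \<omega>"
      using conjugate_mult_mat_vec[OF G Xc] conj_X H(2) Xc Hc B(1) by (simp add: assoc_mult_mat_vec[of _ n n])
  qed
  have conj_conj: "(\<lambda>\<omega>. conjugate (V' \<omega>)) = V" by (simp add: V'_def)
  have X_conj: "X = (\<lambda>\<omega>. B *\<^sub>v conjugate (X \<omega>))"
  proof
    fix \<omega>
    have "B *\<^sub>v (B *\<^sub>v X \<omega>) = (B * B) *\<^sub>v X \<omega>" using B(1) Xc by simp
    then show "X \<omega> = B *\<^sub>v conjugate (X \<omega>)" unfolding conj_X B(3) using Xc by simp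
  qed
  have zero: "map_mat cnj (0\<^sub>m n n) = (0\<^sub>m n n :: complex mat)" "transpose_mat (0\<^sub>m n n) = (0\<^sub>m n n :: complex mat)"
    by auto
  \<comment> \<open>The signal is also uncorrelated with the conjugate noise: writing
    \<open>X\<close> as \<open>B\<close> times its conjugate turns this correlation into
    \<open>B\<close> times the conjugate of \<open>corr M n X V\<close>.\<close>
  have XV': "corr M n X V' = 0\<^sub>m n n"
  proof -
    have "corr M n X V' = B * corr M n (\<lambda>\<omega>. conjugate (X \<omega>)) V'"
      by (subst X_conj) (rule corr_mult_left[OF B(1) sq_integrable_vec_conjugate[OF X] V'])
    also have "corr M n (\<lambda>\<omega>. conjugate (X \<omega>)) V' = 0\<^sub>m n n"
      unfolding V'_def corr_conjugate[OF Xc Vc] XV zero ..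
    finally show ?thesis using B(1) by simp
  qed
  have VX: "corr M n V X = 0\<^sub>m n n" "corr M n V' X = 0\<^sub>m n n"
    unfolding corr_transpose[OF Xc Vc] corr_transpose[OF Xc V'c] XV XV' zero by simp_all
  have V'V': "corr M n V' V' = 0\<^sub>m n n"
    unfolding V'_def corr_conjugate[OF Vc Vc] VV zero ..
  have "corr M n V' V = map_mat cnj (of_real s \<cdot>\<^sub>m G)"
    using corr_conjugate[of V n V' M, OF Vc V'c] unfolding conj_conj VV'[folded V'_def] V'_def[symmetric] .
  then have V'V: "corr M n V' V = of_real s \<cdot>\<^sub>m H"
    unfolding H(2)[symmetric] by (auto intro!: eq_matI)
  \<comment> \<open>One expansion rule for each side and each of \<open>Y\<close> and
    \<open>Z\<close>. The correlations of \<open>X\<close> with \<open>Y\<close> and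
    \<open>Z\<close> come first; the remaining moments expand the left argument and reuse
    them.\<close>
  have right_Y: "corr M n U Y = corr M n U X * H + corr M n U V" if "sq_integrable_vec M n U" for U
    unfolding Y_def by (simp add: corr_add_right[OF GX V that] corr_mult_right[OF G X that] H(1))
  have right_Z: "corr M n U Z = corr M n U X * (B * G) + corr M n U V'" if "sq_integrable_vec M n U" for U
    unfolding Z_eq by (simp add: corr_add_right[OF BX V' that] corr_mult_right[OF HB X that] HBT)
  have left_Y: "corr M n Y U = G * corr M n X U + corr M n V U" if "sq_integrable_vec M n U" for U
    unfolding Y_def by (simp add: corr_add_left[OF GX V that] corr_mult_left[OF G X that])
  have left_Z: "corr M n Z U = H * B * corr M n X U + corr M n V' U" if "sq_integrable_vec M n U" for U
    unfolding Z_eq by (simp add: corr_add_left[OF BX V' that] corr_mult_left[OF HB X that])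
  have BBx: "B * (B * F) = F" if "F \<in> carrier_mat n n" for F
    using B that by (simp add: assoc_mult_mat[of B n n B n F n, symmetric])
  show XY: "corr M n X Y = B * H"
    using right_Y[OF X] XX XV B Hc by simp
  show XZ: "corr M n X Z = G"
    using right_Z[OF X] XX XV' B G by (simp add: BBx)
  show "corr M n Y Y = G * B * H"
    using left_Y[OF Y] right_Y[OF V] XY VX VV B G Hc by (simp add: assoc_mult_mat[of _ n n _ n _ n])
  show "corr M n Y Z = G * G + of_real s \<cdot>\<^sub>m G"
    using left_Y[OF Z] right_Z[OF V] XZ VX VV'[folded V'_def] B G by simp
  show "corr M n Z Z = H * B * G"
    using left_Z[OF Z] right_Z[OF V'] XZ VX V'V' B G Hc by simp
  show "corr M n Z Y = H * H + of_real s \<cdot>\<^sub>m H"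
    using left_Z[OF Y] right_Y[OF V'] XY VX V'V B G Hc
    by (simp add: assoc_mult_mat[of _ n n _ n _ n] BBx)
qed

text \<open>In the shifted form of the autocorrelation, conjugation merely exchanges the roles of
  the row and column indices.\<close>

lemma Gamma_mat_hermitian:
  assumes h: "\<forall>k. k < 0 \<or> k > int L \<longrightarrow> h k = 0"
  shows "map_mat cnj (Gamma_mat \<nu> L h) = transpose_mat (Gamma_mat \<nu> L h)"
  by (rule eq_matI)
    (auto simp: Gamma_mat_def chan_autocorr_shift[OF h, of _ "2 * \<nu>"] mult.commute)

lemma B_mat_facts:
  shows "transpose_mat (B_mat \<nu>) = B_mat \<nu>" "B_mat \<nu> * B_mat \<nu> = 1\<^sub>m (2 * \<nu>)"
    "map_mat cnj (B_mat \<nu>) = B_mat \<nu>"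
proof -
  show "transpose_mat (B_mat \<nu>) = B_mat \<nu>" "map_mat cnj (B_mat \<nu>) = B_mat \<nu>"
    by (auto simp: B_mat_def mat_diag_def)
  have "B_mat \<nu> * B_mat \<nu> = mat_diag (2 * \<nu>) (\<lambda>_. 1)"
    unfolding B_mat_def mat_diag_diag by (rule arg_cong[of _ _ "mat_diag _"]) auto
  then show "B_mat \<nu> * B_mat \<nu> = 1\<^sub>m (2 * \<nu>)" by simp
qed

lemma conjugate_oqam:
  "conjugate (rvec (2 * \<nu>) (oqam a) \<omega>) = B_mat \<nu> *\<^sub>v rvec (2 * \<nu>) (oqam a) \<omega>"
proof (rule eq_vecI)
  fix i assume "i < dim_vec (B_mat \<nu> *\<^sub>v rvec (2 * \<nu>) (oqam a) \<omega>)"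
  then have i: "i < 2 * \<nu>" by (simp add: B_mat_def mat_diag_def)
  then show "conjugate (rvec (2 * \<nu>) (oqam a) \<omega>) $ i = (B_mat \<nu> *\<^sub>v rvec (2 * \<nu>) (oqam a) \<omega>) $ i"
    by (subst mult_mat_vec_index[OF B_mat_carrier])
      (auto simp: rvec_def oqam_def B_mat_def mat_diag_def if_distrib[of "\<lambda>t. t * _"] cong: if_cong)
qed (simp_all add: B_mat_def mat_diag_def rvec_def)

text \<open>The diagonal entries of \<open>A_mat \<nu>\<close> all have modulus 1/2, so twice this
  matrix is unitary.\<close>

lemma A_mat_adjoint:
  shows "mat_adjoint (A_mat \<nu>) \<in> carrier_mat (2 * \<nu>) (2 * \<nu>)"
    and "A_mat \<nu> * mat_adjoint (A_mat \<nu>) = (1 / 4) \<cdot>\<^sub>m 1\<^sub>m (2 * \<nu>)"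
    and "mat_adjoint (A_mat \<nu>) * A_mat \<nu> = (1 / 4) \<cdot>\<^sub>m 1\<^sub>m (2 * \<nu>)"
proof -
  have adj: "mat_adjoint (A_mat \<nu>) = mat_diag (2 * \<nu>) (\<lambda>n. if even n then 1 / 2 else \<i> / 2)"
    by (rule eq_matI) (auto simp: mat_adjoint_def A_mat_def mat_diag_def mat_of_rows_index)
  show "mat_adjoint (A_mat \<nu>) \<in> carrier_mat (2 * \<nu>) (2 * \<nu>)" unfolding adj by simp
  show "A_mat \<nu> * mat_adjoint (A_mat \<nu>) = (1 / 4) \<cdot>\<^sub>m 1\<^sub>m (2 * \<nu>)"
    "mat_adjoint (A_mat \<nu>) * A_mat \<nu> = (1 / 4) \<cdot>\<^sub>m 1\<^sub>m (2 * \<nu>)"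
    unfolding adj unfolding A_mat_def mat_diag_diag by (auto simp: mat_diag_def)
qed

section \<open>Outputs of the two equalizers\<close>

lemma wle_eq:
  fixes K' :: "complex mat"
  assumes X: "sq_integrable_vec M n X" and Y: "sq_integrable_vec M n Y"
    and sol: "\<And>C D. C \<in> carrier_mat n n \<Longrightarrow> D \<in> carrier_mat n n \<Longrightarrow>
      orthogonality M n X Y C D \<longleftrightarrow> C = K' \<and> D = K' * B"
    and c: "K' \<in> carrier_mat n n" "B \<in> carrier_mat n n"
  shows "wle M n X Y \<omega> = K' *\<^sub>v (Y \<omega> + B *\<^sub>v conjugate (Y \<omega>))"
proof -
  have "wle_coeffs M n X Y = (K', K' * B)"
    unfolding wle_coeffs_def
    \<comment> \<open>The equivalence \<open>sol\<close> yields at once that the pair solves the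
      conditions and that it is the only solution, which is what the definite description
      requires.\<close>
    by (rule the_equality) (use sol c in \<open>auto split: prod.splits\<close>)
  then show ?thesis
    using c sq_integrable_vecD(1)[OF Y, of \<omega>]
    by (simp add: wle_def widely_linear_def mult_add_distrib_mat_vec[of _ n n] assoc_mult_mat_vec[of _ n n])
qed

text \<open>Up to a scalar, the matrix inverted by the ROE is \<open>K\<close> conjugated by the
  unitary matrix \<open>2 \<cdot>\<^sub>m A\<close>. Its inverse is the same conjugate of
  \<open>K'\<close>, and the right-hand factor \<open>A'\<close> then meets the \<open>A\<close> in
  \<open>real_only\<close>.\<close>

lemma roe_eq:
  assumes G: "G \<in> carrier_mat (2 * \<nu>) (2 * \<nu>)" and K': "K' \<in> carrier_mat (2 * \<nu>) (2 * \<nu>)"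
    and KK: "wl_gram \<nu> G (of_real \<sigma>2) * K' = 1\<^sub>m (2 * \<nu>)"
    and y: "y \<in> carrier_vec (2 * \<nu>)"
  shows "roe \<nu> G \<sigma>2 y = (2 \<cdot>\<^sub>m A_mat \<nu>) *\<^sub>v (K' *\<^sub>v (y + B_mat \<nu> *\<^sub>v conjugate y))"
proof -
  let ?n = "2 * \<nu>" and ?s = "complex_of_real \<sigma>2"
  define A where "A = A_mat \<nu>"
  define A' where "A' = mat_adjoint (A_mat \<nu>)"
  define R where "R = G + B_mat \<nu> * transpose_mat G * B_mat \<nu>"
  define K where "K = wl_gram \<nu> G ?s"
  define P where "P = Gamma_a \<nu> G + complex_of_real (\<sigma>2 / 2) \<cdot>\<^sub>m 1\<^sub>m ?n"
  \<comment> \<open>The constant is fixed by \<open>P = 2 \<cdot>\<^sub>m (A * K * A')\<close>: the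
    inner product \<open>A' * A\<close> and the outer \<open>A * A'\<close> each contribute 1/4, and
    2 times 8 times 1/16 is 1.\<close>
  define Q where "Q = 8 \<cdot>\<^sub>m (A * K' * A')"
  have A: "A \<in> carrier_mat ?n ?n" "A' \<in> carrier_mat ?n ?n"
    "A * A' = (1 / 4) \<cdot>\<^sub>m 1\<^sub>m ?n" "A' * A = (1 / 4) \<cdot>\<^sub>m 1\<^sub>m ?n"
    using A_mat_adjoint[of \<nu>] by (simp_all add: A_def A'_def)
  have R: "R \<in> carrier_mat ?n ?n" using G by (auto simp: R_def intro!: add_carrier_mat mult_carrier_mat)
  have K_eq: "K = R + ?s \<cdot>\<^sub>m 1\<^sub>m ?n" by (simp add: K_def R_def wl_gram_def)
  have K: "K \<in> carrier_mat ?n ?n" unfolding K_eq using R by simp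
  note ring = assoc_mult_mat[of _ ?n ?n _ ?n _ ?n] add_mult_distrib_mat[of _ ?n ?n _ _ ?n]
    mult_add_distrib_mat[of _ ?n ?n _ ?n _] mult_smult_distrib[of _ ?n ?n _ ?n]
    mult_smult_assoc_mat[of _ ?n ?n _ ?n] right_mult_one_mat[of _ ?n ?n] left_mult_one_mat[of _ ?n ?n]
    mult_carrier_mat[of _ ?n ?n _ ?n] add_carrier_mat[of _ ?n ?n] smult_carrier_mat[of _ ?n ?n]
  have "A * K * A' = A * R * A' + ?s \<cdot>\<^sub>m (A * A')"
    unfolding K_eq using A(1,2) R by (simp add: ring)
  then have "A * K * A' = A * R * A' + ?s \<cdot>\<^sub>m ((1 / 4) \<cdot>\<^sub>m 1\<^sub>m ?n)" using A(3) by simp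
  moreover have "P = 2 \<cdot>\<^sub>m (A * R * A') + (?s / 2) \<cdot>\<^sub>m 1\<^sub>m ?n"
    by (simp add: P_def Gamma_a_def A_def A'_def R_def)
  ultimately have P: "P = 2 \<cdot>\<^sub>m (A * K * A')"
    using A(1,2) R by (auto simp: mat_eq_iff simp del: index_mult_mat(1))
  have Pc: "P \<in> carrier_mat ?n ?n" and Qc: "Q \<in> carrier_mat ?n ?n"
    using A K K' by (simp_all add: P Q_def ring)
  have A'A: "A' * (A * F) = (1 / 4) \<cdot>\<^sub>m F" if "F \<in> carrier_mat ?n ?n" for F
    using A(1,2,4) that by (simp add: assoc_mult_mat[of A' ?n ?n A ?n F ?n, symmetric] mult_smult_assoc_mat[of _ ?n ?n])
  have KK': "K * (K' * F) = F" if "F \<in> carrier_mat ?n ?n" for F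
    using K K' KK[folded K_def] that by (simp add: assoc_mult_mat[of K ?n ?n K' ?n F ?n, symmetric])
  have PQ: "P * Q = 1\<^sub>m ?n"
  proof -
    have "(1::complex) \<cdot>\<^sub>m 1\<^sub>m ?n = 1\<^sub>m ?n" by (auto intro!: eq_matI)
    then show ?thesis using A K K' by (simp add: P Q_def ring A'A KK' smult_smult_mat)
  qed
  \<comment> \<open>The value \<open>None\<close> would mean that \<open>P\<close> is singular,
    which \<open>Q\<close> refutes; any other returned matrix is a left inverse and hence equals the
    right inverse \<open>Q\<close>.\<close>
  have "mat_inverse P = Some Q"
  proof (cases "mat_inverse P")
    case None
    then have "P \<notin> Units (ring_mat TYPE(complex) ?n ())" by (rule mat_inverse(1)[OF Pc])
    then show ?thesis
      using Pc Qc PQ mat_mult_left_right_inverse[OF Pc Qc PQ] by (auto simp: Units_def ring_mat_simps)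
  next
    case (Some Q')
    from mat_inverse(2)[OF Pc Some] have Q': "Q' \<in> carrier_mat ?n ?n" "Q' * P = 1\<^sub>m ?n" by auto
    have "Q' = Q' * (P * Q)" using PQ Q' by simp
    also have "\<dots> = Q" using Q' Pc Qc by (simp add: assoc_mult_mat[of Q' ?n ?n P ?n Q ?n, symmetric])
    finally show ?thesis using Some by simp
  qed
  moreover define u where "u = y + B_mat \<nu> *\<^sub>v conjugate y"
  have u: "u \<in> carrier_vec ?n" using y by (auto simp: u_def intro!: add_carrier_vec mult_mat_vec_carrier[of _ ?n ?n])
  \<comment> \<open>Here 8 times the 1/4 from \<open>A' * A\<close> leaves the factor 2 of the
    claim.\<close>
  have "Q * A = 2 \<cdot>\<^sub>m (A * K')"
    using A K' by (simp add: Q_def ring smult_smult_mat)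
  then have "Q *\<^sub>v (A *\<^sub>v u) = (2 \<cdot>\<^sub>m A * K') *\<^sub>v u"
    using A(1) K' Qc u by (simp add: assoc_mult_mat_vec[of Q ?n ?n A ?n u, symmetric] ring)
  ultimately show ?thesis
    using A(1) K' u unfolding roe_def P_def[symmetric] real_only_eq[OF y] u_def[symmetric] A_def[symmetric]
    by (simp add: assoc_mult_mat_vec[of _ ?n ?n _ ?n])
qed

text \<open>Taking real and imaginary parts is only real-linear, whereas multiplication by
  \<open>2 \<cdot>\<^sub>m A_mat \<nu>\<close> is complex-linear; they agree on vectors fixed by
  conjugation followed by \<open>B\<close>. The vector \<open>x\<close> is of this kind because
  \<open>u\<close> is and \<open>K'\<close> commutes with that antilinear involution.\<close>

lemma real_only_wl:
  assumes G: "G \<in> carrier_mat (2 * \<nu>) (2 * \<nu>)" "map_mat cnj G = transpose_mat G"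
    and K': "K' \<in> carrier_mat (2 * \<nu>) (2 * \<nu>)"
    and KK: "wl_gram \<nu> G (of_real \<sigma>2) * K' = 1\<^sub>m (2 * \<nu>)"
    and y: "y \<in> carrier_vec (2 * \<nu>)"
  defines "x \<equiv> K' *\<^sub>v (y + B_mat \<nu> *\<^sub>v conjugate y)"
  shows "real_only x = (2 \<cdot>\<^sub>m A_mat \<nu>) *\<^sub>v x"
proof -
  let ?n = "2 * \<nu>"
  define B where "B = B_mat \<nu>"
  define H where "H = transpose_mat G"
  define K where "K = wl_gram \<nu> G (of_real \<sigma>2)"
  define u where "u = y + B *\<^sub>v conjugate y"
  note B = B_mat_carrier[of \<nu>, folded B_def] B_mat_facts[of \<nu>, folded B_def]
  have H: "H \<in> carrier_mat ?n ?n" "map_mat cnj G = H" using G by (simp_all add: H_def)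
  have HG: "map_mat cnj H = G" unfolding H(2)[symmetric] by (auto intro!: eq_matI)
  have K_eq: "K = G + B * H * B + of_real \<sigma>2 \<cdot>\<^sub>m 1\<^sub>m ?n" by (simp add: K_def wl_gram_def H_def B_def)
  note ring = assoc_mult_mat[of _ ?n ?n _ ?n _ ?n] add_mult_distrib_mat[of _ ?n ?n _ _ ?n]
    mult_add_distrib_mat[of _ ?n ?n _ ?n _] mult_smult_distrib[of _ ?n ?n _ ?n]
    mult_smult_assoc_mat[of _ ?n ?n _ ?n] right_mult_one_mat[of _ ?n ?n] left_mult_one_mat[of _ ?n ?n]
    mult_carrier_mat[of _ ?n ?n _ ?n] add_carrier_mat[of _ ?n ?n] smult_carrier_mat[of _ ?n ?n]
  have K: "K \<in> carrier_mat ?n ?n" unfolding K_eq using G B H by (simp add: ring)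
  have u: "u \<in> carrier_vec ?n" using y B by (simp add: u_def)
  have BB: "B * (B * F) = F" if "F \<in> carrier_mat ?n ?n" for F
    using B that by (simp add: assoc_mult_mat[of B ?n ?n B ?n F ?n, symmetric])
  have "map_mat cnj K = map_mat cnj G + map_mat cnj (B * H * B) + of_real \<sigma>2 \<cdot>\<^sub>m 1\<^sub>m ?n"
    unfolding K_eq using G(1) B(1) H(1) by (auto intro!: eq_matI simp del: index_mult_mat(1))
  also have "map_mat cnj (B * H * B) = B * G * B"
    using B G(1) H by (simp add: map_mat_cnj_mult[of _ ?n] HG ring)
  finally have cK: "map_mat cnj K = H + B * G * B + of_real \<sigma>2 \<cdot>\<^sub>m 1\<^sub>m ?n" using H(2) by simp
  \<comment> \<open>Conjugation exchanges \<open>G\<close> and \<open>H\<close>, and conjugating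
    with \<open>B\<close> swaps the two channel terms back, so \<open>K\<close> commutes with the
    involution.\<close>
  have "B * map_mat cnj K * B = B * H * B + G + of_real \<sigma>2 \<cdot>\<^sub>m 1\<^sub>m ?n"
    unfolding cK using B G H
    by (simp add: ring BB, intro assoc_add_mat[of _ ?n ?n, symmetric]) (simp_all add: ring)
  also have "\<dots> = K" unfolding K_eq using B G(1) H comm_add_mat[of "B * H * B" ?n ?n G] by (simp add: ring assoc_add_mat[of _ ?n ?n])
  finally have BKB: "B * map_mat cnj K * B = K" .
  have cKc: "map_mat cnj K \<in> carrier_mat ?n ?n" "map_mat cnj K' \<in> carrier_mat ?n ?n" using K K' by auto
  have "map_mat cnj K * map_mat cnj K' = map_mat cnj (1\<^sub>m ?n)"
    unfolding map_mat_cnj_mult[OF K K', symmetric] using KK by (simp add: K_def)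
  also have "\<dots> = 1\<^sub>m ?n" by auto
  finally have cKK: "map_mat cnj K * map_mat cnj K' = 1\<^sub>m ?n" .
  \<comment> \<open>This is \<open>K'\<close> transported through the involution. It is again a
    right inverse of \<open>K\<close>, so it coincides with \<open>K'\<close>.\<close>
  let ?J = "B * map_mat cnj K' * B"
  have J: "?J \<in> carrier_mat ?n ?n" using B cKc by (simp add: ring)
  have KJ: "K * ?J = 1\<^sub>m ?n"
  proof -
    have "K * ?J = B * (map_mat cnj K * map_mat cnj K') * B"
      using B cKc K by (subst BKB[symmetric]) (simp add: ring BB)
    then show ?thesis using B by (simp add: cKK)
  qed
  have "?J = K' * K * ?J"
    using mat_mult_left_right_inverse[OF K K'] KK left_mult_one_mat[OF J] by (simp add: K_def)
  also have "\<dots> = K'" using assoc_mult_mat[OF K' K J] KJ K' by simp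
  finally have J_eq: "?J = K'" .
  have Bu: "B *\<^sub>v conjugate u = u"
  proof -
    have "conjugate u = conjugate y + conjugate (B *\<^sub>v conjugate y)"
      unfolding u_def using B y by (intro conjugate_add_vec[of _ ?n]) auto
    also have "conjugate (B *\<^sub>v conjugate y) = B *\<^sub>v y"
      using conjugate_mult_mat_vec[OF B(1), of "conjugate y"] y B by simp
    finally have "B *\<^sub>v conjugate u = B *\<^sub>v conjugate y + (B * B) *\<^sub>v y"
      using B(1) y by (simp add: mult_add_distrib_mat_vec[of _ ?n ?n])
    then show ?thesis using B y comm_add_vec[of y ?n "B *\<^sub>v conjugate y"] by (simp add: u_def)
  qed
  have xu: "x = K' *\<^sub>v u" by (simp add: x_def u_def B_def)
  have xc: "x \<in> carrier_vec ?n" using K' u by (simp add: xu)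
  have "x = ?J *\<^sub>v (B *\<^sub>v conjugate u)" unfolding J_eq Bu xu ..
  also have "\<dots> = (?J * B) *\<^sub>v conjugate u"
    using J B u by (simp only: assoc_mult_mat_vec[of ?J ?n ?n B ?n] carrier_vec_conjugate)
  also have "?J * B = B * map_mat cnj K'" using B cKc by (simp add: ring)
  also have "(B * map_mat cnj K') *\<^sub>v conjugate u = B *\<^sub>v conjugate x"
    using conjugate_mult_mat_vec[OF K' u] B cKc u by (simp add: xu assoc_mult_mat_vec[of _ ?n ?n _ ?n])
  finally have Bx: "B *\<^sub>v conjugate x = x" by simp
  have "real_only x = A_mat \<nu> *\<^sub>v (x + x)"
    unfolding real_only_eq[OF xc] using Bx by (simp add: B_def)
  also have "x + x = 2 \<cdot>\<^sub>v x" by auto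
  also have "A_mat \<nu> *\<^sub>v (2 \<cdot>\<^sub>v x) = (2 \<cdot>\<^sub>m A_mat \<nu>) *\<^sub>v x"
    using xc by (simp add: mult_mat_vec[of _ ?n ?n] smult_mult_mat_vec[of _ ?n])
  finally show ?thesis .
qed

theorem claim1:
  fixes M :: "'w measure"
    and \<nu> N L :: nat
    and amp N0 \<sigma>2 :: real
    and a :: "nat \<Rightarrow> 'w \<Rightarrow> real"
    and h :: "int \<Rightarrow> complex"
    and v :: "nat \<Rightarrow> 'w \<Rightarrow> complex"
  assumes "prob_space M"
    and "\<nu> \<ge> 1"
    and "amp > 0"
    and "\<exists>k\<ge>1. N = 2 ^ k"
    and "2 * amp\<^sup>2 / real N * (\<Sum>i\<in>{i\<in>{1..N - 1}. odd i}. (real i)\<^sup>2) = 1"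
    and "prob_space.indep_vars M (\<lambda>_. borel) a {..<2 * \<nu>}"
    and "\<And>n. n < 2 * \<nu> \<Longrightarrow> uniform_rv M (pam_symbols amp N) (a n)"
    and "\<And>k. k < 0 \<or> k > int L \<Longrightarrow> h k = 0"
    and "\<exists>k\<in>{0..int L}. h k \<noteq> 0"
    and "N0 > 0"
    and "\<sigma>2 = 2 * N0"
    and "complex_gaussian_vec M (2 * \<nu>) v"
    and "circularly_symmetric M (2 * \<nu>) v"
    and "\<And>n. n < 2 * \<nu> \<Longrightarrow> integral\<^sup>L M (v n) = 0"
    and "expect_mat M (2 * \<nu>) (\<lambda>\<omega>. outer (rvec (2 * \<nu>) v \<omega>) (conjugate (rvec (2 * \<nu>) v \<omega>)))
           = complex_of_real \<sigma>2 \<cdot>\<^sub>m Gamma_mat \<nu> L h"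
    and "expect_mat M (2 * \<nu>) (\<lambda>\<omega>. outer (rvec (2 * \<nu>) v \<omega>) (rvec (2 * \<nu>) v \<omega>))
           = 0\<^sub>m (2 * \<nu>) (2 * \<nu>)"
    and "prob_space.indep_var M
           (PiM {..<2 * \<nu>} (\<lambda>_. borel)) (rfun (2 * \<nu>) (oqam a))
           (PiM {..<2 * \<nu>} (\<lambda>_. borel)) (rfun (2 * \<nu>) v)"
  shows "\<forall>\<omega>\<in>space M.
    (let y = received \<nu> (Gamma_mat \<nu> L h) a v;
         x_roe = roe \<nu> (Gamma_mat \<nu> L h) \<sigma>2 (y \<omega>);
         x_wle = wle M (2 * \<nu>) (rvec (2 * \<nu>) (oqam a)) y \<omega>
     in x_roe = real_only x_wle \<and> x_roe = (2 \<cdot>\<^sub>m A_mat \<nu>) *\<^sub>v x_wle)"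
proof
  interpret prob_space M by fact
  let ?n = "2 * \<nu>" and ?G = "Gamma_mat \<nu> L h" and ?B = "B_mat \<nu>"
  let ?H = "transpose_mat ?G"
  let ?X = "rvec ?n (oqam a)" and ?Y = "received \<nu> ?G a v"
  fix \<omega> assume "\<omega> \<in> space M"
  note Gc = Gamma_mat_carrier[of \<nu> L h]
  have h: "\<forall>k. k < 0 \<or> k > int L \<longrightarrow> h k = 0" using assms(8) by blast
  have \<sigma>: "\<sigma>2 > 0" using assms(10,11) by simp
  have N: "even N" "N > 0" using assms(4) by auto
  have unif: "\<forall>n<2 * \<nu>. uniform_rv M (pam_symbols amp N) (a n)" using assms(7) by blast
  note oqam = oqam_moments[OF assms(3) N assms(5,6) unif]
  have V: "sq_integrable_vec M ?n (rvec ?n v)"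
    by (rule complex_gaussian_vec_sq_integrable[OF assms(12)])
  have XV: "corr M ?n ?X (rvec ?n v) = 0\<^sub>m ?n ?n"
    by (rule corr_indep_zero_mean[OF assms(17) oqam(1) V assms(14)])
  note herm = Gamma_mat_hermitian[OF h, of \<nu>]
  \<comment> \<open>The argument \<open>refl\<close> fixes \<open>H\<close> as the transpose of the
    channel matrix; \<open>herm\<close> identifies it with the entrywise conjugate.\<close>
  note moments = observation_moments[OF oqam(1) V Gc refl herm B_mat_carrier
      B_mat_facts(1,2) conjugate_oqam oqam(2) XV assms(15)[folded corr_def] assms(16)[folded corr_def],
      folded received_def]
  obtain G' where G': "G' \<in> carrier_mat ?n ?n" "?G * G' = 1\<^sub>m ?n" "G' * ?G = 1\<^sub>m ?n"
    by (rule Gamma_mat_inverse[OF h assms(9)])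
  obtain K' where K': "K' \<in> carrier_mat ?n ?n" "wl_gram \<nu> ?G (of_real \<sigma>2) * K' = 1\<^sub>m ?n"
    "K' * wl_gram \<nu> ?G (of_real \<sigma>2) = 1\<^sub>m ?n"
    by (rule wl_gram_inverse[OF h \<sigma>])
  have Hc: "?H \<in> carrier_mat ?n ?n" "transpose_mat G' \<in> carrier_mat ?n ?n" using G'(1) by auto
  have HH: "?H * transpose_mat G' = 1\<^sub>m ?n"
    using transpose_mult[OF G'(1) Gc] G'(3) by simp
  \<comment> \<open>With the moments inserted, orthogonality is literally the pair of normal
    equations, and \<open>wl_gram_def\<close> is the required decomposition of
    \<open>K\<close>.\<close>
  have "orthogonality M ?n ?X ?Y C D \<longleftrightarrow> C = K' \<and> D = K' * ?B"
    if C: "C \<in> carrier_mat ?n ?n" and D: "D \<in> carrier_mat ?n ?n" for C D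
    unfolding orthogonality_iff_corr[OF oqam(1) moments(1) C D] moments(2-)
    by (rule widely_linear_normal_equations[OF B_mat_carrier C D Gc Hc(1) G'(1) Hc(2) K'(1)
          B_mat_facts(2) G'(2) HH wl_gram_def K'(2,3)]) (use \<sigma> in simp)
  then have wle: "wle M ?n ?X ?Y \<omega> = K' *\<^sub>v (?Y \<omega> + ?B *\<^sub>v conjugate (?Y \<omega>))"
    by (intro wle_eq[OF oqam(1) moments(1) _ K'(1)]) simp_all
  note y = sq_integrable_vecD(1)[OF moments(1), of \<omega>]
  show "let y = ?Y; x_roe = roe \<nu> ?G \<sigma>2 (y \<omega>); x_wle = wle M ?n ?X y \<omega>
     in x_roe = real_only x_wle \<and> x_roe = (2 \<cdot>\<^sub>m A_mat \<nu>) *\<^sub>v x_wle"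
    unfolding Let_def wle roe_eq[OF Gc K'(1,2) y]
      real_only_wl[OF Gc herm K'(1,2) y] by simp
qed

end
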